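(* Consider the distributionally robust two-stage stochastic mixed-integer second-order-cone program (DR-TSS-MISOCP) $$\min_{y}\ c^\top y+\max_{P\in\mathcal{P}}\mathbb{E}_P[Q(y,\omega)]\quad\text{s.t. } y\in\mathcal{Y}\cap\{0,1\}^n$$ under the standing assumptions stated in the context, and the decomposition branch-and-cut algorithm described in the context. Suppose there exists an integer $N$ such that after $N$ iterations of the algorithm, each second-stage problem $\mathrm{Sub}(y^k,\omega)$ with $k>N$ is solved to optimality using a branch-and-cut algorithm. Then the algorithm returns an optimal solution of (DR-TSS-MISOCP) after finitely many iterations.
   Context: Notation: $[r]=\{1,\dots,r\}$; $\mathbf{1}$ is the all-ones vector. Problem. $\Omega$ is a finite set of scenarios; the ambiguity set $\mathcal{P}$ is a convex set of probability distributions $p=(p_\omega)_{\omega\in\Omega}$ on $\Omega$, and $\mathbb{E}_P[Q(y,\omega)]=\sum_{\omega\in\Omega}p_\omega Q(y,\omega)$. The set $\mathcal{Y}$ is $$\mathcal{Y}=\{y\in\mathbb{R}^n: Fy\ge a,\ \|f_i^\top y+g_i\|_2\le h_i^\top y+e_i\ \forall i\in[m_1],\ 0\le y_j\le1\ \forall j\in[n]\}.$$ $Q(y,\omega)$ is the optimal value of the second-stage problem $\mathrm{Sub}(y,\omega)$: minimize $q^{\omega\top}x$ over $x\in\mathbb{Z}^{l_1}\times\mathbb{R}^{l_2}$ subject to $\|A_i^\omega x+B_i^\omega y+b_i^\omega\|_2\le g_i^{\omega\top}x+d_i^\omega$ for $i\in[m]$, $W^\omega x\ge r^\omega-T^\omega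 y$, and $x_i\in[z_i^{L\omega},z_i^{U\omega}]$ for $i\in[l_1+l_2]$. Write $\mathcal{Z}^\omega=\{x\in\mathbb{R}^{l_1+l_2}: z_i^{L\omega}\le x_i\le z_i^{U\omega}\ \forall i\in[l_1+l_2]\}$. Standing assumptions. (a) Complete recourse: every first-stage feasible solution $y$ leads to a feasible second-stage problem for all scenarios. (b) For every first-stage feasible $y$, every $\omega\in\Omega$ and every $x^1\in\mathbb{Z}^{l_1}$ satisfying $x^1_i\in[z_i^{L\omega},z_i^{U\omega}]$, there exists $x^2\in\mathbb{R}^{l_2}$ such that $x=[x^1;x^2]$ is strictly feasible for $\mathrm{Sub}(y,\omega)$. Branch-and-cut tree. Solving $\mathrm{Sub}(y^k,\omega)$ (possibly only partially) by the branch-and-cut method yields a branch-and-cut tree with set of leaf nodes $\mathcal{L}(y^k,\omega)$. A leaf $v$ has lower and upper bound vectors $z_v^{L\omega},z_v^{U\omega}$ for $x$ (for continuous coordinates these are the original bounds) and box $\mathcal{Z}_v^\omega=\{x: z_v^{L\omega}\le x\le z_v^{U\omega}\}$; as a consequence of the standing assumptions the leaf nodes are taken to form a partition of $\mathcal{Z}^\omega$, i.e. $\mathcal{Z}^\omega=\bigcup_{v\in\mathcal{L}(y^k,\omega)}\mathcal{Z}_v^\omega$. At $v$ there may be additional structure-based cuts $X_v^\omega x\ge t_v^\omega$ used to tighten the second-stage formulation associated with $v$ (absent if no such cuts are generated). The node relaxation at $v$ is: minimize $q^{\omega\top}x$ over $x\in\mathbb{R}^{l_1+l_2}$ subject to $\|A_i^\omega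 x+B_i^\omega y^k+b_i^\omega\|_2\le g_i^{\omega\top}x+d_i^\omega$ $(i\in[m])$, $W^\omega x\ge r^\omega-T^\omega y^k$, $X_v^\omega x\ge t_v^\omega$, $z_v^{L\omega}\le x\le z_v^{U\omega}$. Its dual is: maximize $$\Big[\sum_i\theta_i^\top B_i^\omega-\gamma_1^\top T^\omega\Big]y^k+\sum_i(b_i^{\omega\top}\theta_i-d_i^\omega\lambda_i)+r^{\omega\top}\gamma_1+t_v^{\omega\top}\gamma_2+z_v^{L\omega\top}\tau_L-z_v^{U\omega\top}\tau_U$$ subject to $\sum_i(g_i^\omega\lambda_i-A_i^{\omega\top}\theta_i)+W^{\omega\top}\gamma_1+X_v^{\omega\top}\gamma_2+\tau_L-\tau_U=q^\omega$, $\|\theta_i\|_2\le\lambda_i$ and $\lambda_i\ge0$ $(i\in[m])$, $\gamma_1,\gamma_2,\tau_L,\tau_U\ge0$. With the dual variable values determined by solving the node relaxation, put $R^{k\omega v}=\sum_iB_i^{\omega\top}\theta_i-T^{\omega\top}\gamma_1$ and $S^{k\omega v}=\sum_i(b_i^{\omega\top}\theta_i-d_i^\omega\lambda_i)+r^{\omega\top}\gamma_1+t_v^{\omega\top}\gamma_2+z_v^{L\omega\top}\tau_L-z_v^{U\omega\top}\tau_U$. Scenario based optimality constraint: $\eta^\omega\ge\lambda^{k\omega\top}y+\zeta^{k\omega}$, where $(\lambda^{k\omega},\zeta^{k\omega})$ is the $(\lambda,\zeta)$-part of an optimal solution of the linear program: maximize $\lambda^\top y^k+\zeta$ over $\lambda,\zeta,\sigma_v\ge0,\gamma_v\ge0$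 $(v\in\mathcal{L}(y^k,\omega))$ subject to, for all $v\in\mathcal{L}(y^k,\omega)$, $\lambda-R^{k\omega v}+F^\top\sigma_v-\gamma_v\le0$ and $\zeta-\sigma_v^\top a-S^{k\omega v}+\gamma_v^\top\mathbf{1}\le0$. Algorithm, with termination tolerance $\epsilon$. Initialize $L\gets-\infty$, $U\gets\infty$, $k\gets1$. While $U-L>\epsilon$: 1. Solve to optimality the first-stage (master) problem: minimize $c^\top y+\eta$ over $y\in\mathcal{Y}\cap\{0,1\}^n$, $\eta\in\mathbb{R}$, subject to the aggregated optimality constraints added in iterations $1,\dots,k-1$. Let $(\eta^k,y^k)$ be the optimal solution. 2. Set $L$ to the current optimal value of the master problem, and set the current best solution $y^*\gets y^k$. 3. For each $\omega\in\Omega$: solve $\mathrm{Sub}(y^k,\omega)$ to a suitable accuracy using the branch-and-cut method; let $x^{k\omega}$ be the best feasible solution identified; derive the scenario based optimality constraint with coefficients $(\lambda^{k\omega},\zeta^{k\omega})$. 4. Let $p^k$ be an optimal solution of $\max_{p\in\mathcal{P}}\sum_{\omega\in\Omega}p_\omega(\lambda^{k\omega\top}y^k+\zeta^{k\omega})$ (the current worst-case probability distribution), and add to the master problem the aggregated optimality constraint $\eta\ge\sum_{\omega\in\Omega}p^k_\omega\lambda^{k\omega\top}y+\sum_{\omega\in\Omega}p^k_\omega\zeta^{k\omega}$. 5. Update $U\gets\min\{U,\ c^\top y^k+\sum_{\omega\in\Omega}p^k_\omega q^{\omega\top}x^{k\omega}\}$. 6. $k\gets k+1$. After the loop, return $y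^*$.
   Formalization: y* is kept as the incumbent attaining U; "suitable accuracy" means the value entering U bounds the objective at y^k; node cuts are valid for all feasible y; each leaf contains a mixed-integer point; for ε>0 the returned solution is ε-optimal, optimal for ε=0. *)

theory Defs
  imports "HOL-Analysis.Analysis"
begin

(* Vectors and matrices have type-indexed dimensions: 'n first-stage variables, 'l second-stage
   variables, 'f and 'w rows of F and W, 's and 'k rows inside the second-order cones, and the
   finite type 'o of scenarios.  Cone blocks of different sizes (or matrices W of different heights)
   fit into one type by padding with zero rows, which changes neither the norms nor the
   constraints.  The order on real^'n is componentwise.

   The integer coordinates of x are those in the set intc, so real^'l plays the role of
   R^(l1+l2); intc may be empty or everything, so l1 = 0 and l2 = 0 are allowed. *)

record ('n::finite, 'l::finite, 'o::finite, 'f::finite, 's::finite, 'k::finite, 'w::finite) problem =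
  fst_c :: "real^'n"
  fst_F :: "real^'n^'f"
  fst_a :: "real^'f"
  fst_m :: nat
  fst_f :: "nat \<Rightarrow> real^'s^'n"
  fst_g :: "nat \<Rightarrow> real^'s"
  fst_h :: "nat \<Rightarrow> real^'n"
  fst_e :: "nat \<Rightarrow> real"
  ambiguity :: "(real^'o) set"
  intc :: "'l set"
  snd_q :: "'o \<Rightarrow> real^'l"
  snd_m :: nat
  snd_A :: "'o \<Rightarrow> nat \<Rightarrow> real^'l^'k"
  snd_B :: "'o \<Rightarrow> nat \<Rightarrow> real^'n^'k"
  snd_b :: "'o \<Rightarrow> nat \<Rightarrow> real^'k"
  snd_g :: "'o \<Rightarrow> nat \<Rightarrow> real^'l"
  snd_d :: "'o \<Rightarrow> nat \<Rightarrow> real"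
  snd_W :: "'o \<Rightarrow> real^'l^'w"
  snd_r :: "'o \<Rightarrow> real^'w"
  snd_T :: "'o \<Rightarrow> real^'n^'w"
  snd_zL :: "'o \<Rightarrow> real^'l"
  snd_zU :: "'o \<Rightarrow> real^'l"

section \<open>The two-stage problem\<close>

definition Yset :: "('n::finite,'l::finite,'o::finite,'f::finite,'s::finite,'k::finite,'w::finite) problem
    \<Rightarrow> (real^'n) set" where
  "Yset P = {y. fst_a P \<le> fst_F P *v y
      \<and> (\<forall>i\<in>{1..fst_m P}. norm (transpose (fst_f P i) *v y + fst_g P i) \<le> fst_h P i \<bullet> y + fst_e P i)
      \<and> (\<forall>j. 0 \<le> y $ j \<and> y $ j \<le> 1)}"

definition first_stage :: "('n::finite,'l::finite,'o::finite,'f::finite,'s::finite,'k::finite,'w::finite) problem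
    \<Rightarrow> (real^'n) set" where
  "first_stage P = Yset P \<inter> {y. \<forall>j. y $ j \<in> {0, 1}}"

definition distributions :: "(real^'o::finite) set" where
  "distributions = {p. (\<forall>\<omega>. 0 \<le> p $ \<omega>) \<and> (\<Sum>\<omega>\<in>UNIV. p $ \<omega>) = 1}"

definition cone_slack :: "('n::finite,'l::finite,'o::finite,'f::finite,'s::finite,'k::finite,'w::finite) problem
    \<Rightarrow> real^'n \<Rightarrow> 'o \<Rightarrow> nat \<Rightarrow> real^'l \<Rightarrow> real" where
  "cone_slack P y \<omega> i x = snd_g P \<omega> i \<bullet> x + snd_d P \<omega> i
      - norm (snd_A P \<omega> i *v x + snd_B P \<omega> i *v y + snd_b P \<omega> i)"

definition mixed_integer :: "('n::finite,'l::finite,'o::finite,'f::finite,'s::finite,'k::finite,'w::finite) problem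
    \<Rightarrow> (real^'l) set" where
  "mixed_integer P = {x. \<forall>i\<in>intc P. x $ i \<in> \<int>}"

definition Zbox :: "('n::finite,'l::finite,'o::finite,'f::finite,'s::finite,'k::finite,'w::finite) problem
    \<Rightarrow> 'o \<Rightarrow> (real^'l) set" where
  "Zbox P \<omega> = {x. snd_zL P \<omega> \<le> x \<and> x \<le> snd_zU P \<omega>}"

definition sub_feasible :: "('n::finite,'l::finite,'o::finite,'f::finite,'s::finite,'k::finite,'w::finite) problem
    \<Rightarrow> real^'n \<Rightarrow> 'o \<Rightarrow> (real^'l) set" where
  "sub_feasible P y \<omega> = {x \<in> mixed_integer P. (\<forall>i\<in>{1..snd_m P}. 0 \<le> cone_slack P y \<omega> i x)
      \<and> snd_r P \<omega> - snd_T P \<omega> *v y \<le> snd_W P \<omega> *v x \<and> x \<in> Zbox P \<omega>}"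

definition Q :: "('n::finite,'l::finite,'o::finite,'f::finite,'s::finite,'k::finite,'w::finite) problem
    \<Rightarrow> real^'n \<Rightarrow> 'o \<Rightarrow> real" where
  "Q P y \<omega> = (INF x\<in>sub_feasible P y \<omega>. snd_q P \<omega> \<bullet> x)"

definition dr_objective :: "('n::finite,'l::finite,'o::finite,'f::finite,'s::finite,'k::finite,'w::finite) problem
    \<Rightarrow> real^'n \<Rightarrow> real" where
  "dr_objective P y = fst_c P \<bullet> y + (SUP p\<in>ambiguity P. \<Sum>\<omega>\<in>UNIV. p $ \<omega> * Q P y \<omega>)"

definition dr_optimal :: "('n::finite,'l::finite,'o::finite,'f::finite,'s::finite,'k::finite,'w::finite) problem
    \<Rightarrow> real^'n \<Rightarrow> bool" where
  "dr_optimal P y \<longleftrightarrow> y \<in> first_stage P \<and> (\<forall>y'\<in>first_stage P. dr_objective P y \<le> dr_objective P y')"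

definition dr_optimal_within :: "real \<Rightarrow>
    ('n::finite,'l::finite,'o::finite,'f::finite,'s::finite,'k::finite,'w::finite) problem
    \<Rightarrow> real^'n \<Rightarrow> bool" where
  "dr_optimal_within \<epsilon> P y \<longleftrightarrow>
     y \<in> first_stage P \<and> (\<forall>y'\<in>first_stage P. dr_objective P y \<le> dr_objective P y' + \<epsilon>)"

definition complete_recourse :: "('n::finite,'l::finite,'o::finite,'f::finite,'s::finite,'k::finite,'w::finite) problem
    \<Rightarrow> bool" where
  "complete_recourse P \<longleftrightarrow> (\<forall>y\<in>first_stage P. \<forall>\<omega>. sub_feasible P y \<omega> \<noteq> {})"

(* Strict feasibility concerns the conic constraints; the linear ones hold weakly (integer
   coordinates at a bound could not satisfy the bounds strictly).  Only the coordinates of x1 in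
   intc matter. *)
definition strict_recourse :: "('n::finite,'l::finite,'o::finite,'f::finite,'s::finite,'k::finite,'w::finite) problem
    \<Rightarrow> bool" where
  "strict_recourse P \<longleftrightarrow> (\<forall>y\<in>first_stage P. \<forall>\<omega>. \<forall>x1.
      (\<forall>i\<in>intc P. x1 $ i \<in> \<int> \<and> snd_zL P \<omega> $ i \<le> x1 $ i \<and> x1 $ i \<le> snd_zU P \<omega> $ i) \<longrightarrow>
      (\<exists>x\<in>sub_feasible P y \<omega>. (\<forall>i\<in>intc P. x $ i = x1 $ i)
         \<and> (\<forall>i\<in>{1..snd_m P}. 0 < cone_slack P y \<omega> i x)))"

section \<open>Branch-and-cut trees and node relaxations\<close>

(* node_cuts lists the rows (X_v row, t_v entry) of the cuts at the node; [] if there are none. *)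
record 'l::finite node =
  node_lo :: "real^'l"
  node_up :: "real^'l"
  node_cuts :: "((real^'l) \<times> real) list"

record ('l::finite, 'k::finite, 'w::finite) node_dual =
  du_theta :: "nat \<Rightarrow> real^'k"
  du_lambda :: "nat \<Rightarrow> real"
  du_gamma1 :: "real^'w"
  du_gamma2 :: "nat \<Rightarrow> real"
  du_tauL :: "real^'l"
  du_tauU :: "real^'l"

definition node_box :: "'l::finite node \<Rightarrow> (real^'l) set" where
  "node_box v = {x. node_lo v \<le> x \<and> x \<le> node_up v}"

definition satisfies_cuts :: "'l::finite node \<Rightarrow> real^'l \<Rightarrow> bool" where
  "satisfies_cuts v x \<longleftrightarrow> (\<forall>(\<xi>, t)\<in>set (node_cuts v). t \<le> \<xi> \<bullet> x)"

(* The leaves partition Z in the sense of branching: the boxes lie in Z, none of them is void of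
   mixed-integer points, and together they cover the mixed-integer points of Z (branching on
   x_i <= s or x_i >= s+1 drops the fractional slab in between).  The cuts at a leaf tighten the
   second-stage formulation, so they are valid for its mixed-integer points whatever the
   first-stage decision; otherwise the optimality constraints below would not be valid. *)
definition bc_leaves :: "('n::finite,'l::finite,'o::finite,'f::finite,'s::finite,'k::finite,'w::finite) problem
    \<Rightarrow> 'o \<Rightarrow> 'l node set \<Rightarrow> bool" where
  "bc_leaves P \<omega> V \<longleftrightarrow> finite V
     \<and> (\<Union>v\<in>V. node_box v) \<subseteq> Zbox P \<omega>
     \<and> Zbox P \<omega> \<inter> mixed_integer P \<subseteq> (\<Union>v\<in>V. node_box v)
     \<and> (\<forall>v\<in>V. node_box v \<inter> mixed_integer P \<noteq> {})
     \<and> (\<forall>v\<in>V. \<forall>i. i \<notin> intc P \<longrightarrow> node_lo v $ i = snd_zL P \<omega> $ i \<and> node_up v $ i = snd_zU P \<omega> $ i)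
     \<and> (\<forall>v\<in>V. \<forall>y\<in>first_stage P. \<forall>x\<in>sub_feasible P y \<omega> \<inter> node_box v. satisfies_cuts v x)"

definition relax_feasible :: "('n::finite,'l::finite,'o::finite,'f::finite,'s::finite,'k::finite,'w::finite) problem
    \<Rightarrow> real^'n \<Rightarrow> 'o \<Rightarrow> 'l node \<Rightarrow> (real^'l) set" where
  "relax_feasible P y \<omega> v = {x. (\<forall>i\<in>{1..snd_m P}. 0 \<le> cone_slack P y \<omega> i x)
      \<and> snd_r P \<omega> - snd_T P \<omega> *v y \<le> snd_W P \<omega> *v x \<and> satisfies_cuts v x \<and> x \<in> node_box v}"

definition dual_feasible :: "('n::finite,'l::finite,'o::finite,'f::finite,'s::finite,'k::finite,'w::finite) problem
    \<Rightarrow> 'o \<Rightarrow> 'l node \<Rightarrow> ('l,'k,'w) node_dual \<Rightarrow> bool" where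
  "dual_feasible P \<omega> v \<delta> \<longleftrightarrow>
     (\<Sum>i\<in>{1..snd_m P}. du_lambda \<delta> i *\<^sub>R snd_g P \<omega> i - transpose (snd_A P \<omega> i) *v du_theta \<delta> i)
       + transpose (snd_W P \<omega>) *v du_gamma1 \<delta>
       + (\<Sum>j<length (node_cuts v). du_gamma2 \<delta> j *\<^sub>R fst (node_cuts v ! j))
       + du_tauL \<delta> - du_tauU \<delta> = snd_q P \<omega>
     \<and> (\<forall>i\<in>{1..snd_m P}. norm (du_theta \<delta> i) \<le> du_lambda \<delta> i \<and> 0 \<le> du_lambda \<delta> i)
     \<and> 0 \<le> du_gamma1 \<delta> \<and> (\<forall>j<length (node_cuts v). 0 \<le> du_gamma2 \<delta> j)
     \<and> 0 \<le> du_tauL \<delta> \<and> 0 \<le> du_tauU \<delta>"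

definition Rcoef :: "('n::finite,'l::finite,'o::finite,'f::finite,'s::finite,'k::finite,'w::finite) problem
    \<Rightarrow> 'o \<Rightarrow> ('l,'k,'w) node_dual \<Rightarrow> real^'n" where
  "Rcoef P \<omega> \<delta> = (\<Sum>i\<in>{1..snd_m P}. transpose (snd_B P \<omega> i) *v du_theta \<delta> i)
      - transpose (snd_T P \<omega>) *v du_gamma1 \<delta>"

definition Scoef :: "('n::finite,'l::finite,'o::finite,'f::finite,'s::finite,'k::finite,'w::finite) problem
    \<Rightarrow> 'o \<Rightarrow> 'l node \<Rightarrow> ('l,'k,'w) node_dual \<Rightarrow> real" where
  "Scoef P \<omega> v \<delta> = (\<Sum>i\<in>{1..snd_m P}. snd_b P \<omega> i \<bullet> du_theta \<delta> i - snd_d P \<omega> i * du_lambda \<delta> i)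
      + snd_r P \<omega> \<bullet> du_gamma1 \<delta>
      + (\<Sum>j<length (node_cuts v). snd (node_cuts v ! j) * du_gamma2 \<delta> j)
      + node_lo v \<bullet> du_tauL \<delta> - node_up v \<bullet> du_tauU \<delta>"

definition dual_optimal :: "('n::finite,'l::finite,'o::finite,'f::finite,'s::finite,'k::finite,'w::finite) problem
    \<Rightarrow> real^'n \<Rightarrow> 'o \<Rightarrow> 'l node \<Rightarrow> ('l,'k,'w) node_dual \<Rightarrow> bool" where
  "dual_optimal P y \<omega> v \<delta> \<longleftrightarrow> dual_feasible P \<omega> v \<delta>
     \<and> (\<forall>\<delta>'. dual_feasible P \<omega> v \<delta>' \<longrightarrow>
          Rcoef P \<omega> \<delta>' \<bullet> y + Scoef P \<omega> v \<delta>' \<le> Rcoef P \<omega> \<delta> \<bullet> y + Scoef P \<omega> v \<delta>)"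

section \<open>Scenario based optimality constraints\<close>

definition cut_lp_feasible :: "('n::finite,'l::finite,'o::finite,'f::finite,'s::finite,'k::finite,'w::finite) problem
    \<Rightarrow> 'o \<Rightarrow> 'l node set \<Rightarrow> ('l node \<Rightarrow> ('l,'k,'w) node_dual) \<Rightarrow> real^'n \<Rightarrow> real \<Rightarrow> bool" where
  "cut_lp_feasible P \<omega> V \<delta> lam \<zeta> \<longleftrightarrow>
     (\<exists>(\<sigma> :: 'l node \<Rightarrow> real^'f) (\<gamma> :: 'l node \<Rightarrow> real^'n). \<forall>v\<in>V. 0 \<le> \<sigma> v \<and> 0 \<le> \<gamma> v
        \<and> lam - Rcoef P \<omega> (\<delta> v) + transpose (fst_F P) *v \<sigma> v - \<gamma> v \<le> 0
        \<and> \<zeta> - \<sigma> v \<bullet> fst_a P - Scoef P \<omega> v (\<delta> v) + \<gamma> v \<bullet> 1 \<le> 0)"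

definition cut_lp_optimal :: "('n::finite,'l::finite,'o::finite,'f::finite,'s::finite,'k::finite,'w::finite) problem
    \<Rightarrow> real^'n \<Rightarrow> 'o \<Rightarrow> 'l node set \<Rightarrow> ('l node \<Rightarrow> ('l,'k,'w) node_dual) \<Rightarrow> real^'n \<Rightarrow> real \<Rightarrow> bool" where
  "cut_lp_optimal P y \<omega> V \<delta> lam \<zeta> \<longleftrightarrow> cut_lp_feasible P \<omega> V \<delta> lam \<zeta>
     \<and> (\<forall>lam' \<zeta>'. cut_lp_feasible P \<omega> V \<delta> lam' \<zeta>' \<longrightarrow> lam' \<bullet> y + \<zeta>' \<le> lam \<bullet> y + \<zeta>)"

section \<open>The decomposition branch-and-cut algorithm\<close>

(* The objects produced in one iteration; it_dual gives the dual values at each leaf. *)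
record ('n::finite, 'l::finite, 'o::finite, 'k::finite, 'w::finite) iteration =
  it_y :: "real^'n"
  it_eta :: real
  it_leaves :: "'o \<Rightarrow> 'l node set"
  it_dual :: "'o \<Rightarrow> 'l node \<Rightarrow> ('l,'k,'w) node_dual"
  it_x :: "'o \<Rightarrow> real^'l"
  it_lambda :: "'o \<Rightarrow> real^'n"
  it_zeta :: "'o \<Rightarrow> real"
  it_p :: "real^'o"

(* A run is the sequence of its iterations, numbered from 1; the entries that the loop does not
   reach (and entry 0) carry no meaning. *)
type_synonym ('n,'l,'o,'k,'w) run = "nat \<Rightarrow> ('n,'l,'o,'k,'w) iteration"

definition master_feasible :: "('n::finite,'l::finite,'o::finite,'f::finite,'s::finite,'k::finite,'w::finite) problem
    \<Rightarrow> ('n,'l,'o,'k,'w) run \<Rightarrow> nat \<Rightarrow> ((real^'n) \<times> real) set" where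
  "master_feasible P \<rho> k = {(y, \<eta>). y \<in> first_stage P \<and> (\<forall>j\<in>{1..<k}.
      (\<Sum>\<omega>\<in>UNIV. it_p (\<rho> j) $ \<omega> * (it_lambda (\<rho> j) \<omega> \<bullet> y))
        + (\<Sum>\<omega>\<in>UNIV. it_p (\<rho> j) $ \<omega> * it_zeta (\<rho> j) \<omega>) \<le> \<eta>)}"

(* Without optimality constraints (k = 1) the master problem is unbounded in eta; then its value is
   -\<infinity> and y may be any feasible first-stage decision. *)
definition master_optimal :: "('n::finite,'l::finite,'o::finite,'f::finite,'s::finite,'k::finite,'w::finite) problem
    \<Rightarrow> ('n,'l,'o,'k,'w) run \<Rightarrow> nat \<Rightarrow> real^'n \<Rightarrow> real \<Rightarrow> bool" where
  "master_optimal P \<rho> k y \<eta> \<longleftrightarrow> y \<in> first_stage P \<and>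
     (1 < k \<longrightarrow> (y, \<eta>) \<in> master_feasible P \<rho> k
        \<and> (\<forall>(y', \<eta>')\<in>master_feasible P \<rho> k. fst_c P \<bullet> y + \<eta> \<le> fst_c P \<bullet> y' + \<eta>'))"

definition upper_value :: "('n::finite,'l::finite,'o::finite,'f::finite,'s::finite,'k::finite,'w::finite) problem
    \<Rightarrow> ('n,'l,'o,'k,'w) iteration \<Rightarrow> real" where
  "upper_value P I = fst_c P \<bullet> it_y I + (\<Sum>\<omega>\<in>UNIV. it_p I $ \<omega> * (snd_q P \<omega> \<bullet> it_x I \<omega>))"

(* The accuracy of the second-stage solutions is suitable when the value entering U really is an
   upper bound on the objective at the current y.  Since p maximizes the expectation of the lower
   approximations and not of the second-stage values, this is not automatic; it does hold when the
   second-stage problems are solved to optimality, or when the ambiguity set is a singleton. *)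
definition suitable_accuracy :: "('n::finite,'l::finite,'o::finite,'f::finite,'s::finite,'k::finite,'w::finite) problem
    \<Rightarrow> ('n,'l,'o,'k,'w) iteration \<Rightarrow> bool" where
  "suitable_accuracy P I \<longleftrightarrow> dr_objective P (it_y I) \<le> upper_value P I"

definition worst_case_distribution :: "('n::finite,'l::finite,'o::finite,'f::finite,'s::finite,'k::finite,'w::finite) problem
    \<Rightarrow> ('n,'l,'o,'k,'w) iteration \<Rightarrow> bool" where
  "worst_case_distribution P I \<longleftrightarrow> it_p I \<in> ambiguity P
     \<and> (\<forall>p\<in>ambiguity P. (\<Sum>\<omega>\<in>UNIV. p $ \<omega> * (it_lambda I \<omega> \<bullet> it_y I + it_zeta I \<omega>))
          \<le> (\<Sum>\<omega>\<in>UNIV. it_p I $ \<omega> * (it_lambda I \<omega> \<bullet> it_y I + it_zeta I \<omega>)))"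

definition valid_iteration :: "('n::finite,'l::finite,'o::finite,'f::finite,'s::finite,'k::finite,'w::finite) problem
    \<Rightarrow> ('n,'l,'o,'k,'w) run \<Rightarrow> nat \<Rightarrow> bool" where
  "valid_iteration P \<rho> k \<longleftrightarrow> (let I = \<rho> k in
     master_optimal P \<rho> k (it_y I) (it_eta I)
     \<and> (\<forall>\<omega>. bc_leaves P \<omega> (it_leaves I \<omega>)
          \<and> (\<forall>v\<in>it_leaves I \<omega>. dual_optimal P (it_y I) \<omega> v (it_dual I \<omega> v))
          \<and> it_x I \<omega> \<in> sub_feasible P (it_y I) \<omega>
          \<and> cut_lp_optimal P (it_y I) \<omega> (it_leaves I \<omega>) (it_dual I \<omega>) (it_lambda I \<omega>) (it_zeta I \<omega>))
     \<and> suitable_accuracy P I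
     \<and> worst_case_distribution P I)"

(* L and U after k iterations.  The infimum is -\<infinity> for k = 1. *)
definition lower_bound :: "('n::finite,'l::finite,'o::finite,'f::finite,'s::finite,'k::finite,'w::finite) problem
    \<Rightarrow> ('n,'l,'o,'k,'w) run \<Rightarrow> nat \<Rightarrow> ereal" where
  "lower_bound P \<rho> k = (if k = 0 then -\<infinity>
     else (INF (y, \<eta>)\<in>master_feasible P \<rho> k. ereal (fst_c P \<bullet> y + \<eta>)))"

primrec upper_bound :: "('n::finite,'l::finite,'o::finite,'f::finite,'s::finite,'k::finite,'w::finite) problem
    \<Rightarrow> ('n,'l,'o,'k,'w) run \<Rightarrow> nat \<Rightarrow> ereal" where
  "upper_bound P \<rho> 0 = \<infinity>"
| "upper_bound P \<rho> (Suc k) = min (upper_bound P \<rho> k) (ereal (upper_value P (\<rho> (Suc k))))"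

(* The current best solution y* after k iterations: the new y becomes the best one unless an earlier
   iterate has a strictly smaller upper value.  (Overwriting y* unconditionally would lose the
   incumbent when the last master problem has several optimal solutions.)  The value for k = 0 is
   irrelevant, as at least one iteration is performed. *)
primrec best_solution :: "('n::finite,'l::finite,'o::finite,'f::finite,'s::finite,'k::finite,'w::finite) problem
    \<Rightarrow> ('n,'l,'o,'k,'w) run \<Rightarrow> nat \<Rightarrow> real^'n" where
  "best_solution P \<rho> 0 = 0"
| "best_solution P \<rho> (Suc k) =
     (if ereal (upper_value P (\<rho> (Suc k))) \<le> upper_bound P \<rho> k then it_y (\<rho> (Suc k))
      else best_solution P \<rho> k)"

definition continues :: "('n::finite,'l::finite,'o::finite,'f::finite,'s::finite,'k::finite,'w::finite) problem
    \<Rightarrow> real \<Rightarrow> ('n,'l,'o,'k,'w) run \<Rightarrow> nat \<Rightarrow> bool" where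
  "continues P \<epsilon> \<rho> k \<longleftrightarrow> upper_bound P \<rho> k - lower_bound P \<rho> k > ereal \<epsilon>"

definition performs :: "('n::finite,'l::finite,'o::finite,'f::finite,'s::finite,'k::finite,'w::finite) problem
    \<Rightarrow> real \<Rightarrow> ('n,'l,'o,'k,'w) run \<Rightarrow> nat \<Rightarrow> bool" where
  "performs P \<epsilon> \<rho> k \<longleftrightarrow> 1 \<le> k \<and> (\<forall>j<k. continues P \<epsilon> \<rho> j)"

definition algorithm_run :: "('n::finite,'l::finite,'o::finite,'f::finite,'s::finite,'k::finite,'w::finite) problem
    \<Rightarrow> real \<Rightarrow> ('n,'l,'o,'k,'w) run \<Rightarrow> bool" where
  "algorithm_run P \<epsilon> \<rho> \<longleftrightarrow> (\<forall>k. performs P \<epsilon> \<rho> k \<longrightarrow> valid_iteration P \<rho> k)"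

definition returns_after :: "('n::finite,'l::finite,'o::finite,'f::finite,'s::finite,'k::finite,'w::finite) problem
    \<Rightarrow> real \<Rightarrow> ('n,'l,'o,'k,'w) run \<Rightarrow> nat \<Rightarrow> real^'n \<Rightarrow> bool" where
  "returns_after P \<epsilon> \<rho> K y \<longleftrightarrow>
     performs P \<epsilon> \<rho> K \<and> \<not> continues P \<epsilon> \<rho> K \<and> y = best_solution P \<rho> K"

(* Branch-and-cut has finished: x is optimal and no leaf is open, i.e. no node relaxation has a
   value below that of x. *)
definition solved_to_optimality :: "('n::finite,'l::finite,'o::finite,'f::finite,'s::finite,'k::finite,'w::finite) problem
    \<Rightarrow> ('n,'l,'o,'k,'w) iteration \<Rightarrow> 'o \<Rightarrow> bool" where
  "solved_to_optimality P I \<omega> \<longleftrightarrow>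
     (\<forall>x\<in>sub_feasible P (it_y I) \<omega>. snd_q P \<omega> \<bullet> it_x I \<omega> \<le> snd_q P \<omega> \<bullet> x)
     \<and> (\<forall>v\<in>it_leaves I \<omega>. \<forall>x\<in>relax_feasible P (it_y I) \<omega> v. snd_q P \<omega> \<bullet> it_x I \<omega> \<le> snd_q P \<omega> \<bullet> x)"

end

theory Submission
  imports Defs
begin

(* The optimality constraints underestimate Q by weak duality, so L never exceeds the optimal value.
   They are tight at the current iterate once the second-stage problems are solved to optimality:
   the feasible set of a node relaxation is compact and nonempty, which excludes a duality gap, and
   as the iterate is a vertex of the unit cube, an affine function with a steep slope away from it
   attains the smallest leaf value there.  Hence a first-stage decision that comes up twice after
   iteration N closes the gap, and there are only finitely many decisions. *)

text \<open>The dual feasible set of a leaf does not involve the first-stage decision, so dual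
  values computed at one iterate bound the leaf from below at every decision. Tightness is the
  harder half, for two reasons. Linear rows and cuts at a leaf may hold with equality at all its
  feasible points, so a strictly feasible point may be missing. Multipliers are therefore
  constructed only for bounds \<open>c' < c\<close>; this suffices, because the dual solution
  carried by the run is optimal and dominates all of them. Moreover the smallest leaf value is a
  minimum of affine functions of y, hence concave, and an affine function below it on the whole cube
  generally touches it at no interior point; at a vertex it can. No distributions of different
  iterations are ever compared: the upper value and the aggregated constraint of one iteration carry
  the same weights.\<close>

section \<open>Conic duality\<close>

text \<open>Separation of convex sets gives a multiplier for the constraint and one for the
  objective; the strictly feasible \<open>x0\<close> makes the latter nonzero, so that it can be
  normalised to 1.\<close>

lemma cone_multiplier:
  fixes M :: "real^'l^'k" and X :: "(real^'l) set"
  assumes "convex X" and x0: "x0 \<in> X" "norm (M *v x0 + \<beta>) < g \<bullet> x0 + d"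
    and bound: "\<And>x. x \<in> X \<Longrightarrow> norm (M *v x + \<beta>) \<le> g \<bullet> x + d \<Longrightarrow> c \<le> q \<bullet> x"
  obtains \<theta> l where "norm \<theta> \<le> l"
    "\<And>x. x \<in> X \<Longrightarrow> c \<le> q \<bullet> x - (l * (g \<bullet> x + d) - \<theta> \<bullet> (M *v x + \<beta>))"
proof -
  \<comment> \<open>\<open>C\<close> records constraint value and objective excess of the points of
    \<open>X\<close>. A point common to \<open>C\<close> and \<open>D\<close> would come from a
    feasible \<open>x\<close> with objective below \<open>c\<close>.\<close>
  define C where "C = (\<lambda>x. (M *v x + \<beta>, g \<bullet> x + d, q \<bullet> x - c)) ` X"
  define D :: "((real^'k) \<times> real \<times> real) set" where "D = {(u, s, t). norm u \<le> s \<and> t < 0}"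
  have "convex C"
  proof (rule convexI)
    fix z1 z2 and a b :: real
    assume z: "z1 \<in> C" "z2 \<in> C" and ab: "0 \<le> a" "0 \<le> b" "a + b = 1"
    then obtain x1 x2 where x: "x1 \<in> X" "z1 = (M *v x1 + \<beta>, g \<bullet> x1 + d, q \<bullet> x1 - c)"
      "x2 \<in> X" "z2 = (M *v x2 + \<beta>, g \<bullet> x2 + d, q \<bullet> x2 - c)"
      unfolding C_def by blast
    have b: "b = 1 - a" using ab by simp
    have "a *\<^sub>R x1 + b *\<^sub>R x2 \<in> X"
      using \<open>convex X\<close> x ab by (simp add: convexD)
    moreover have "a *\<^sub>R z1 + b *\<^sub>R z2 = (M *v (a *\<^sub>R x1 + b *\<^sub>R x2) + \<beta>,
        g \<bullet> (a *\<^sub>R x1 + b *\<^sub>R x2) + d, q \<bullet> (a *\<^sub>R x1 + b *\<^sub>R x2) - c)"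
      unfolding x b
      by (simp add: matrix_vector_right_distrib matrix_vector_mult_scaleR inner_add_right algebra_simps)
    ultimately show "a *\<^sub>R z1 + b *\<^sub>R z2 \<in> C"
      unfolding C_def by blast
  qed
  moreover have "convex D"
  proof (rule convexI)
    fix z1 z2 and a b :: real
    assume z: "z1 \<in> D" "z2 \<in> D" and ab: "0 \<le> a" "0 \<le> b" "a + b = 1"
    obtain u1 s1 t1 u2 s2 t2 where e: "z1 = (u1, s1, t1)" "z2 = (u2, s2, t2)"
      by (metis prod_cases3)
    have h: "norm u1 \<le> s1" "norm u2 \<le> s2" "t1 < 0" "t2 < 0"
      using z unfolding D_def e by auto
    have "norm (a *\<^sub>R u1 + b *\<^sub>R u2) \<le> a * norm u1 + b * norm u2"
      using norm_triangle_ineq[of "a *\<^sub>R u1" "b *\<^sub>R u2"] ab by simp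
    also have "\<dots> \<le> a * s1 + b * s2"
      using h ab by (intro add_mono mult_left_mono)
    finally have 1: "norm (a *\<^sub>R u1 + b *\<^sub>R u2) \<le> a * s1 + b * s2" .
    have "a * t1 + b * t2 < 0"
      using convex_bound_lt[of t1 0 t2 a b] h ab by simp
    with 1 show "a *\<^sub>R z1 + b *\<^sub>R z2 \<in> D"
      unfolding D_def e by simp
  qed
  moreover have "C \<noteq> {}" using x0 by (auto simp: C_def)
  moreover have D0: "(0, 0, -1) \<in> D" by (simp add: D_def)
  moreover have "D \<inter> C = {}"
    unfolding C_def D_def using bound by force
  ultimately obtain n bnd where n: "n \<noteq> 0" "\<forall>z\<in>D. n \<bullet> z \<le> bnd" "\<forall>z\<in>C. bnd \<le> n \<bullet> z"
    using separating_hyperplane_sets[of D C] by blast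
  obtain \<theta> l' e where n_eq: "n = (\<theta>, l', e)" by (metis prod_cases3)
  define l where "l = - l'"
  \<comment> \<open>\<open>D\<close> is closed under positive scaling, so a linear function bounded
    above on it cannot be positive anywhere on it.\<close>
  have neg: "n \<bullet> z \<le> 0" if "z \<in> D" for z
  proof (rule ccontr)
    assume pos: "\<not> n \<bullet> z \<le> 0"
    define r where "r = (\<bar>bnd\<bar> + 1) / (n \<bullet> z)"
    have "r > 0" using pos by (simp add: r_def)
    then have "r *\<^sub>R z \<in> D"
      using that unfolding D_def by (auto simp: mult_pos_neg)
    then have "n \<bullet> (r *\<^sub>R z) \<le> bnd" using n by blast
    then show False using pos by (simp add: r_def)
  qed
  \<comment> \<open>The origin is not in \<open>D\<close>, only a limit of its points
    \<open>(0, 0, - r)\<close>; \<open>r\<close> is chosen so that the error \<open>e * r\<close>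
    stays below the given tolerance. The same device gives \<open>cone\<close> below.\<close>
  have "0 \<le> bnd"
  proof (rule field_le_epsilon)
    fix s :: real assume "0 < s"
    define r where "r = s / (\<bar>e\<bar> + 1)"
    have "r > 0" using \<open>0 < s\<close> by (simp add: r_def)
    then have "(0, 0, - r) \<in> D" by (simp add: D_def)
    then have "n \<bullet> (0, 0, - r) \<le> bnd" using n by blast
    then have "- (e * r) \<le> bnd" by (simp add: n_eq)
    moreover have "e * r \<le> s"
      using \<open>0 < s\<close> by (simp add: r_def field_simps abs_if)
    ultimately show "0 \<le> bnd + s" by simp
  qed
  then have C_ge: "0 \<le> \<theta> \<bullet> (M *v x + \<beta>) - l * (g \<bullet> x + d) + e * (q \<bullet> x - c)" if "x \<in> X" for x
    using that n(3) by (fastforce simp: C_def n_eq l_def)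
  have "e \<ge> 0" using neg[OF D0] by (simp add: n_eq)
  have cone: "\<theta> \<bullet> u \<le> l * s" if "norm u \<le> s" for u s
  proof (rule field_le_epsilon)
    fix t :: real assume "0 < t"
    define r where "r = t / (\<bar>e\<bar> + 1)"
    have "r > 0" using \<open>0 < t\<close> by (simp add: r_def)
    then have "(u, s, - r) \<in> D" using that by (simp add: D_def)
    from neg[OF this] have "\<theta> \<bullet> u \<le> l * s + e * r" by (simp add: n_eq l_def)
    moreover have "e * r \<le> t"
      using \<open>0 < t\<close> by (simp add: r_def field_simps abs_if)
    ultimately show "\<theta> \<bullet> u \<le> l * s + t" by simp
  qed
  have nl: "norm \<theta> \<le> l"
  proof (cases "\<theta> = 0")
    case True
    then show ?thesis using cone[of 0 1] by simp
  next
    case False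
    have "norm \<theta> * norm \<theta> \<le> l * norm \<theta>"
      using cone[of \<theta> "norm \<theta>"] by (simp add: dot_square_norm power2_eq_square)
    then show ?thesis using False by simp
  qed
  \<comment> \<open>With \<open>e = 0\<close> the separation at \<open>x0\<close> would force
    \<open>l = 0\<close> by strict feasibility, then \<open>\<theta> = 0\<close>, and the normal
    \<open>n\<close> would vanish.\<close>
  have "e > 0"
  proof (rule ccontr)
    assume "\<not> e > 0"
    then have e0: "e = 0" using \<open>e \<ge> 0\<close> by simp
    define u where "u = M *v x0 + \<beta>"
    have "l * (g \<bullet> x0 + d) \<le> \<theta> \<bullet> u"
      using C_ge[OF x0(1)] e0 by (simp add: u_def)
    also have "\<dots> \<le> l * norm u" by (rule cone) simp
    finally have "l * (g \<bullet> x0 + d) \<le> l * norm u" .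
    moreover have "0 \<le> l" using nl norm_ge_zero order_trans by blast
    ultimately have "l = 0" using x0(2) by (auto simp: u_def mult_le_cancel_left)
    then show False using nl n(1) e0 by (simp add: n_eq l_def zero_prod_def)
  qed
  show ?thesis
  proof (rule that[of "\<theta> /\<^sub>R e" "l / e"])
    show "norm (\<theta> /\<^sub>R e) \<le> l / e"
      using nl \<open>e > 0\<close> by (simp add: divide_right_mono divide_inverse_commute)
    fix x assume "x \<in> X"
    from C_ge[OF this]
    have "0 \<le> (\<theta> \<bullet> (M *v x + \<beta>) - l * (g \<bullet> x + d) + e * (q \<bullet> x - c)) / e"
      using \<open>e > 0\<close> by simp
    also have "\<dots> = (\<theta> /\<^sub>R e) \<bullet> (M *v x + \<beta>) - l / e * (g \<bullet> x + d) + (q \<bullet> x - c)"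
      using \<open>e > 0\<close> by (simp add: field_simps)
    finally show "c \<le> q \<bullet> x - (l / e * (g \<bullet> x + d) - (\<theta> /\<^sub>R e) \<bullet> (M *v x + \<beta>))"
      by simp
  qed
qed

lemma convex_cone_constraint:
  fixes M :: "real^'l^'k"
  shows "convex {x. norm (M *v x + \<beta>) \<le> g \<bullet> x + d}"
proof (rule convexI, simp)
  fix x y :: "real^'l" and a b :: real
  assume h: "norm (M *v x + \<beta>) \<le> g \<bullet> x + d" "norm (M *v y + \<beta>) \<le> g \<bullet> y + d"
    and ab: "0 \<le> a" "0 \<le> b" "a + b = 1"
  have b: "b = 1 - a" using ab by simp
  have "norm (M *v (a *\<^sub>R x + b *\<^sub>R y) + \<beta>) = norm (a *\<^sub>R (M *v x + \<beta>) + b *\<^sub>R (M *v y + \<beta>))"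
    unfolding b
    by (simp add: matrix_vector_right_distrib matrix_vector_mult_scaleR algebra_simps)
  also have "\<dots> \<le> a * norm (M *v x + \<beta>) + b * norm (M *v y + \<beta>)"
    using norm_triangle_ineq[of "a *\<^sub>R (M *v x + \<beta>)" "b *\<^sub>R (M *v y + \<beta>)"] ab by simp
  also have "\<dots> \<le> a * (g \<bullet> x + d) + b * (g \<bullet> y + d)"
    using h ab by (intro add_mono mult_left_mono)
  also have "\<dots> = g \<bullet> (a *\<^sub>R x + b *\<^sub>R y) + d"
    unfolding b by (simp add: inner_add_right algebra_simps)
  finally show "norm (M *v (a *\<^sub>R x + b *\<^sub>R y) + \<beta>) \<le> g \<bullet> (a *\<^sub>R x + b *\<^sub>R y) + d" .
qed

text \<open>Cones are dualised one at a time: the multiplier of cone \<open>j\<close> is found over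
  the part of \<open>X\<close> cut out by the other cones, and its term is affine in
  \<open>x\<close>, so it can be absorbed into the objective. This is why the induction generalises
  over \<open>c\<close> and \<open>q\<close>.\<close>

lemma cone_multipliers:
  fixes M :: "'i \<Rightarrow> real^'l^'k" and X :: "(real^'l) set"
  assumes "finite I" and "convex X" and "x0 \<in> X"
    and "\<And>i. i \<in> I \<Longrightarrow> norm (M i *v x0 + \<beta> i) < g i \<bullet> x0 + d i"
    and "\<And>x. x \<in> X \<Longrightarrow> (\<And>i. i \<in> I \<Longrightarrow> norm (M i *v x + \<beta> i) \<le> g i \<bullet> x + d i) \<Longrightarrow> c \<le> q \<bullet> x"
  shows "\<exists>\<theta> l. (\<forall>i\<in>I. norm (\<theta> i) \<le> l i)
     \<and> (\<forall>x\<in>X. c \<le> q \<bullet> x - (\<Sum>i\<in>I. l i * (g i \<bullet> x + d i) - \<theta> i \<bullet> (M i *v x + \<beta> i)))"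
  using assms
proof (induction I arbitrary: c q rule: finite_induct)
  case empty
  then show ?case by simp
next
  case (insert j I)
  define X' where "X' = X \<inter> (\<Inter>i\<in>I. {x. norm (M i *v x + \<beta> i) \<le> g i \<bullet> x + d i})"
  have "convex X'"
    unfolding X'_def using insert.prems(1)
    by (intro convex_Int convex_INT) (auto intro: convex_cone_constraint)
  moreover have "x0 \<in> X'"
    using insert.prems(2,3) by (auto simp: X'_def intro: less_imp_le)
  moreover have "norm (M j *v x0 + \<beta> j) < g j \<bullet> x0 + d j"
    using insert.prems(3) by simp
  moreover have "c \<le> q \<bullet> x" if "x \<in> X'" "norm (M j *v x + \<beta> j) \<le> g j \<bullet> x + d j" for x
    using that by (intro insert.prems(4)) (auto simp: X'_def)
  ultimately obtain \<theta>j lj where j: "norm \<theta>j \<le> lj"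
    "\<And>x. x \<in> X' \<Longrightarrow> c \<le> q \<bullet> x - (lj * (g j \<bullet> x + d j) - \<theta>j \<bullet> (M j *v x + \<beta> j))"
    using cone_multiplier[of X' x0 "M j" "\<beta> j" "g j" "d j" c q] by blast
  \<comment> \<open>Linear part and constant of the objective after cone \<open>j\<close> has been
    moved into it.\<close>
  define q' where "q' = q - lj *\<^sub>R g j + transpose (M j) *v \<theta>j"
  define c' where "c' = c + lj * d j - \<theta>j \<bullet> \<beta> j"
  have tr: "q \<bullet> x - (lj * (g j \<bullet> x + d j) - \<theta>j \<bullet> (M j *v x + \<beta> j)) - c = q' \<bullet> x - c'" for x
    by (simp add: q'_def c'_def inner_add_left inner_diff_left inner_add_right
        dot_lmul_matrix algebra_simps)
  have "c' \<le> q' \<bullet> x" if "x \<in> X" "\<And>i. i \<in> I \<Longrightarrow> norm (M i *v x + \<beta> i) \<le> g i \<bullet> x + d i" for x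
    using j(2)[of x] tr[of x] that by (auto simp: X'_def)
  then obtain \<theta> l where I: "\<forall>i\<in>I. norm (\<theta> i) \<le> l i"
    "\<forall>x\<in>X. c' \<le> q' \<bullet> x - (\<Sum>i\<in>I. l i * (g i \<bullet> x + d i) - \<theta> i \<bullet> (M i *v x + \<beta> i))"
    using insert.IH[of c' q'] insert.prems by auto
  have *: "(\<Sum>i\<in>insert j I. (l(j := lj)) i * (g i \<bullet> x + d i) - (\<theta>(j := \<theta>j)) i \<bullet> (M i *v x + \<beta> i))
     = lj * (g j \<bullet> x + d j) - \<theta>j \<bullet> (M j *v x + \<beta> j)
       + (\<Sum>i\<in>I. l i * (g i \<bullet> x + d i) - \<theta> i \<bullet> (M i *v x + \<beta> i))" for x
  proof -
    have "(\<Sum>i\<in>I. (l(j := lj)) i * (g i \<bullet> x + d i) - (\<theta>(j := \<theta>j)) i \<bullet> (M i *v x + \<beta> i))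
       = (\<Sum>i\<in>I. l i * (g i \<bullet> x + d i) - \<theta> i \<bullet> (M i *v x + \<beta> i))"
      using insert.hyps(2) by (intro sum.cong) auto
    then show ?thesis using insert.hyps by simp
  qed
  show ?case
  proof (intro exI conjI ballI)
    show "norm ((\<theta>(j := \<theta>j)) i) \<le> (l(j := lj)) i" if "i \<in> insert j I" for i
      using that I(1) j(1) by auto
    show "c \<le> q \<bullet> x - (\<Sum>i\<in>insert j I. (l(j := lj)) i * (g i \<bullet> x + d i)
        - (\<theta>(j := \<theta>j)) i \<bullet> (M i *v x + \<beta> i))" if "x \<in> X" for x
      using I(2)[rule_format, OF that] tr[of x] unfolding * by simp
  qed
qed

(* Compactness replaces Slater's condition: relaxing all constraints by a small amount makes the
   feasible point strictly feasible and changes the optimal value only slightly. *)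
lemma cone_multipliers_compact:
  fixes M :: "'i \<Rightarrow> real^'l^'k" and X :: "(real^'l) set"
  assumes "finite I" and "convex X" and "compact X" and "x0 \<in> X"
    and x0: "\<And>i. i \<in> I \<Longrightarrow> norm (M i *v x0 + \<beta> i) \<le> g i \<bullet> x0 + d i"
    and bound: "\<And>x. x \<in> X \<Longrightarrow> (\<And>i. i \<in> I \<Longrightarrow> norm (M i *v x + \<beta> i) \<le> g i \<bullet> x + d i) \<Longrightarrow> c \<le> q \<bullet> x"
    and "c' < c"
  shows "\<exists>\<theta> l. (\<forall>i\<in>I. norm (\<theta> i) \<le> l i)
     \<and> (\<forall>x\<in>X. c' \<le> q \<bullet> x - (\<Sum>i\<in>I. l i * (g i \<bullet> x + d i) - \<theta> i \<bullet> (M i *v x + \<beta> i)))"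
proof -
  \<comment> \<open>Otherwise points satisfying the constraints up to \<open>1/(n+1)\<close> with
    objective below \<open>c'\<close> would accumulate at a feasible point of objective at most
    \<open>c' < c\<close>.\<close>
  have "\<exists>r>0. \<forall>x\<in>X. (\<forall>i\<in>I. norm (M i *v x + \<beta> i) \<le> g i \<bullet> x + (d i + r)) \<longrightarrow> c' \<le> q \<bullet> x"
  proof (rule ccontr)
    assume "\<not> ?thesis"
    then have "\<exists>x\<in>X. (\<forall>i\<in>I. norm (M i *v x + \<beta> i) \<le> g i \<bullet> x + (d i + inverse (real (Suc n)))) \<and> q \<bullet> x < c'" for n
      by (metis inverse_positive_iff_positive not_le of_nat_0_less_iff zero_less_Suc)
    then obtain s where s: "\<And>n. s n \<in> X" "\<And>n. q \<bullet> s n < c'"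
      "\<And>n i. i \<in> I \<Longrightarrow> norm (M i *v s n + \<beta> i) \<le> g i \<bullet> s n + (d i + inverse (real (Suc n)))"
      by metis
    obtain x r where x: "x \<in> X" "strict_mono r" "(s \<circ> r) \<longlonglongrightarrow> x"
      using \<open>compact X\<close> s(1) unfolding compact_def by blast
    have sr: "(\<lambda>n. s (r n)) \<longlonglongrightarrow> x" using x(3) by (simp add: o_def)
    have inv: "(\<lambda>n. inverse (real (Suc (r n)))) \<longlonglongrightarrow> 0"
      using LIMSEQ_subseq_LIMSEQ[OF LIMSEQ_inverse_real_of_nat x(2)] by (simp add: o_def)
    have "norm (M i *v x + \<beta> i) \<le> g i \<bullet> x + (d i + 0)" if "i \<in> I" for i
    proof (rule LIMSEQ_le)
      show "(\<lambda>n. norm (M i *v s (r n) + \<beta> i)) \<longlonglongrightarrow> norm (M i *v x + \<beta> i)"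
        using sr by (intro tendsto_intros bounded_linear.tendsto[OF matrix_vector_mul_bounded_linear])
      show "(\<lambda>n. g i \<bullet> s (r n) + (d i + inverse (real (Suc (r n))))) \<longlonglongrightarrow> g i \<bullet> x + (d i + 0)"
        using sr inv by (intro tendsto_intros)
    qed (use s(3)[OF that] in auto)
    then have "c \<le> q \<bullet> x" using bound x(1) by simp
    moreover have "q \<bullet> x \<le> c'"
      by (rule LIMSEQ_le_const2[of "\<lambda>n. q \<bullet> s (r n)"])
        (use sr s(2) in \<open>auto intro!: tendsto_intros less_imp_le\<close>)
    ultimately show False using \<open>c' < c\<close> by simp
  qed
  then obtain r where r: "r > 0"
    "\<And>x. x \<in> X \<Longrightarrow> (\<And>i. i \<in> I \<Longrightarrow> norm (M i *v x + \<beta> i) \<le> g i \<bullet> x + (d i + r)) \<Longrightarrow> c' \<le> q \<bullet> x"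
    by blast
  have "norm (M i *v x0 + \<beta> i) < g i \<bullet> x0 + (d i + r)" if "i \<in> I" for i
    using x0[OF that] r(1) by simp
  from cone_multipliers[where \<beta> = \<beta> and g = g and d = "\<lambda>i. d i + r", OF assms(1,2,4) this r(2)]
  obtain \<theta> l where I: "\<forall>i\<in>I. norm (\<theta> i) \<le> l i"
    "\<forall>x\<in>X. c' \<le> q \<bullet> x - (\<Sum>i\<in>I. l i * (g i \<bullet> x + (d i + r)) - \<theta> i \<bullet> (M i *v x + \<beta> i))"
    by blast
  \<comment> \<open>Since \<open>l i\<close> is nonnegative, taking the relaxation \<open>r\<close>
    back only shrinks the subtracted sum, so the same multipliers serve the original
    constraints.\<close>
  have "(\<Sum>i\<in>I. l i * (g i \<bullet> x + d i) - \<theta> i \<bullet> (M i *v x + \<beta> i))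
     \<le> (\<Sum>i\<in>I. l i * (g i \<bullet> x + (d i + r)) - \<theta> i \<bullet> (M i *v x + \<beta> i))" for x
  proof (intro sum_mono diff_right_mono mult_left_mono)
    show "0 \<le> l i" if "i \<in> I" for i
      using I(1) that norm_ge_zero order_trans by blast
  qed (use r(1) in auto)
  with I show ?thesis by (meson diff_left_mono order_trans)
qed

section \<open>Duality for the node relaxations\<close>

lemma inner_left_mono_vec: "0 \<le> a \<Longrightarrow> x \<le> y \<Longrightarrow> a \<bullet> x \<le> a \<bullet> y" for a x y :: "real^'n"
  by (auto simp: inner_vec_def less_eq_vec_def intro!: sum_mono mult_left_mono)

lemma satisfies_cuts_nth:
  "satisfies_cuts v x \<longleftrightarrow> (\<forall>j<length (node_cuts v). snd (node_cuts v ! j) \<le> fst (node_cuts v ! j) \<bullet> x)"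
  by (simp add: satisfies_cuts_def case_prod_beta all_set_conv_all_nth)

lemma Rcoef_inner:
  "Rcoef P \<omega> \<delta> \<bullet> y = (\<Sum>i\<in>{1..snd_m P}. du_theta \<delta> i \<bullet> (snd_B P \<omega> i *v y)) - du_gamma1 \<delta> \<bullet> (snd_T P \<omega> *v y)"
  by (simp add: Rcoef_def inner_diff_left inner_sum_left dot_lmul_matrix)

text \<open>The dual equation rewrites the objective, after which each constraint contributes one
  inequality (Cauchy-Schwarz for the cones). Here \<open>y\<close> is arbitrary and need not be the
  decision at which \<open>\<delta>\<close> was computed; the validity of the optimality constraints
  rests on this.\<close>

lemma node_weak_duality:
  assumes "dual_feasible P \<omega> v \<delta>" and x: "x \<in> relax_feasible P y \<omega> v"
  shows "Rcoef P \<omega> \<delta> \<bullet> y + Scoef P \<omega> v \<delta> \<le> snd_q P \<omega> \<bullet> x"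
proof -
  note d = assms(1)[unfolded dual_feasible_def]
  have "snd_q P \<omega> = (\<Sum>i\<in>{1..snd_m P}. du_lambda \<delta> i *\<^sub>R snd_g P \<omega> i - transpose (snd_A P \<omega> i) *v du_theta \<delta> i)
       + transpose (snd_W P \<omega>) *v du_gamma1 \<delta>
       + (\<Sum>j<length (node_cuts v). du_gamma2 \<delta> j *\<^sub>R fst (node_cuts v ! j))
       + du_tauL \<delta> - du_tauU \<delta>"
    using d by simp
  then have q: "snd_q P \<omega> \<bullet> x =
      (\<Sum>i\<in>{1..snd_m P}. du_lambda \<delta> i * (snd_g P \<omega> i \<bullet> x) - du_theta \<delta> i \<bullet> (snd_A P \<omega> i *v x))
       + du_gamma1 \<delta> \<bullet> (snd_W P \<omega> *v x)
       + (\<Sum>j<length (node_cuts v). du_gamma2 \<delta> j * (fst (node_cuts v ! j) \<bullet> x))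
       + du_tauL \<delta> \<bullet> x - du_tauU \<delta> \<bullet> x"
    by (simp add: inner_add_left inner_diff_left inner_sum_left dot_lmul_matrix)
  have "(\<Sum>i\<in>{1..snd_m P}. du_theta \<delta> i \<bullet> (snd_B P \<omega> i *v y))
      + (\<Sum>i\<in>{1..snd_m P}. snd_b P \<omega> i \<bullet> du_theta \<delta> i - snd_d P \<omega> i * du_lambda \<delta> i)
    \<le> (\<Sum>i\<in>{1..snd_m P}. du_lambda \<delta> i * (snd_g P \<omega> i \<bullet> x) - du_theta \<delta> i \<bullet> (snd_A P \<omega> i *v x))"
    unfolding sum.distrib[symmetric]
  proof (rule sum_mono)
    fix i assume i: "i \<in> {1..snd_m P}"
    define u where "u = snd_A P \<omega> i *v x + snd_B P \<omega> i *v y + snd_b P \<omega> i"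
    have l: "norm (du_theta \<delta> i) \<le> du_lambda \<delta> i" "0 \<le> du_lambda \<delta> i" using d i by auto
    have u: "norm u \<le> snd_g P \<omega> i \<bullet> x + snd_d P \<omega> i"
      using x i by (auto simp: relax_feasible_def cone_slack_def u_def)
    have "du_theta \<delta> i \<bullet> u \<le> norm (du_theta \<delta> i) * norm u" by (rule norm_cauchy_schwarz)
    also have "\<dots> \<le> du_lambda \<delta> i * (snd_g P \<omega> i \<bullet> x + snd_d P \<omega> i)"
      using l u by (intro mult_mono) auto
    finally show "du_theta \<delta> i \<bullet> (snd_B P \<omega> i *v y) + (snd_b P \<omega> i \<bullet> du_theta \<delta> i - snd_d P \<omega> i * du_lambda \<delta> i)
        \<le> du_lambda \<delta> i * (snd_g P \<omega> i \<bullet> x) - du_theta \<delta> i \<bullet> (snd_A P \<omega> i *v x)"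
      by (simp add: u_def inner_add_right inner_commute algebra_simps)
  qed
  moreover have "du_gamma1 \<delta> \<bullet> (snd_r P \<omega> - snd_T P \<omega> *v y) \<le> du_gamma1 \<delta> \<bullet> (snd_W P \<omega> *v x)"
    using d x by (intro inner_left_mono_vec) (auto simp: relax_feasible_def)
  moreover have "(\<Sum>j<length (node_cuts v). snd (node_cuts v ! j) * du_gamma2 \<delta> j)
      \<le> (\<Sum>j<length (node_cuts v). du_gamma2 \<delta> j * (fst (node_cuts v ! j) \<bullet> x))"
  proof (rule sum_mono)
    fix j assume "j \<in> {..<length (node_cuts v)}"
    then have "snd (node_cuts v ! j) \<le> fst (node_cuts v ! j) \<bullet> x" "0 \<le> du_gamma2 \<delta> j"
      using d x by (auto simp: relax_feasible_def satisfies_cuts_nth)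
    then show "snd (node_cuts v ! j) * du_gamma2 \<delta> j \<le> du_gamma2 \<delta> j * (fst (node_cuts v ! j) \<bullet> x)"
      by (simp add: mult.commute mult_left_mono)
  qed
  moreover have "du_tauL \<delta> \<bullet> node_lo v \<le> du_tauL \<delta> \<bullet> x"
    using d x by (intro inner_left_mono_vec) (auto simp: relax_feasible_def node_box_def)
  moreover have "du_tauU \<delta> \<bullet> x \<le> du_tauU \<delta> \<bullet> node_up v"
    using d x by (intro inner_left_mono_vec) (auto simp: relax_feasible_def node_box_def)
  ultimately show ?thesis
    unfolding q Rcoef_inner Scoef_def by (simp add: inner_diff_right inner_commute)
qed

text \<open>Cones, linear rows and cuts are dualised over the box of the leaf, which supplies the
  compactness; the multipliers of the box itself are then explicit.\<close>

lemma node_strong_duality: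
  fixes P :: "('n::finite,'l::finite,'o::finite,'f::finite,'s::finite,'k::finite,'w::finite) problem"
  assumes "relax_feasible P y \<omega> v \<noteq> {}"
    and bound: "\<And>x. x \<in> relax_feasible P y \<omega> v \<Longrightarrow> c \<le> snd_q P \<omega> \<bullet> x" and "c' < c"
  shows "\<exists>\<delta>. dual_feasible P \<omega> v \<delta> \<and> c' \<le> Rcoef P \<omega> \<delta> \<bullet> y + Scoef P \<omega> v \<delta>"
proof -
  let ?n = "length (node_cuts v)" and ?\<xi> = "\<lambda>j. fst (node_cuts v ! j)" and ?t = "\<lambda>j. snd (node_cuts v ! j)"
  \<comment> \<open>A single family for all constraints: a linear inequality is a cone constraint
    whose norm part is zero, so its multiplier \<open>l\<close> becomes an entry of
    \<open>\<gamma>1\<close> or \<open>\<gamma>2\<close>.\<close>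
  define I where "I = {1..snd_m P} <+> ({..<?n} <+> (UNIV :: 'w set))"
  define M :: "nat + nat + 'w \<Rightarrow> real^'l^'k" where "M = case_sum (snd_A P \<omega>) (\<lambda>_. 0)"
  define \<beta> :: "nat + nat + 'w \<Rightarrow> real^'k" where
    "\<beta> = case_sum (\<lambda>i. snd_B P \<omega> i *v y + snd_b P \<omega> i) (\<lambda>_. 0)"
  define g :: "nat + nat + 'w \<Rightarrow> real^'l" where
    "g = case_sum (snd_g P \<omega>) (case_sum ?\<xi> (\<lambda>w. snd_W P \<omega> $ w))"
  define d :: "nat + nat + 'w \<Rightarrow> real" where
    "d = case_sum (snd_d P \<omega>) (case_sum (\<lambda>j. - ?t j) (\<lambda>w. - (snd_r P \<omega> - snd_T P \<omega> *v y) $ w))"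
  have feas: "x \<in> relax_feasible P y \<omega> v"
    if "x \<in> node_box v" "\<And>i. i \<in> I \<Longrightarrow> norm (M i *v x + \<beta> i) \<le> g i \<bullet> x + d i" for x
    unfolding relax_feasible_def mem_Collect_eq
  proof (intro conjI ballI)
    fix i assume "i \<in> {1..snd_m P}"
    then show "0 \<le> cone_slack P y \<omega> i x"
      using that(2)[of "Inl i"]
      by (simp add: I_def M_def \<beta>_def g_def d_def cone_slack_def add.assoc InlI)
  next
    show "snd_r P \<omega> - snd_T P \<omega> *v y \<le> snd_W P \<omega> *v x"
      unfolding less_eq_vec_def
    proof
      fix w show "(snd_r P \<omega> - snd_T P \<omega> *v y) $ w \<le> (snd_W P \<omega> *v x) $ w"
        using that(2)[of "Inr (Inr w)"]
        by (simp add: I_def M_def \<beta>_def g_def d_def matrix_vector_mul_component InrI)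
    qed
  next
    show "satisfies_cuts v x"
      unfolding satisfies_cuts_nth
    proof (intro allI impI)
      fix j assume "j < ?n"
      then show "?t j \<le> ?\<xi> j \<bullet> x"
        using that(2)[of "Inr (Inl j)"]
        by (simp add: I_def M_def \<beta>_def g_def d_def InlI InrI)
    qed
  qed (rule that(1))
  obtain x0 where x0: "x0 \<in> relax_feasible P y \<omega> v" using assms(1) by blast
  then have box0: "x0 \<in> node_box v" by (simp add: relax_feasible_def)
  have sat0: "norm (M i *v x0 + \<beta> i) \<le> g i \<bullet> x0 + d i" if "i \<in> I" for i
    using that x0
    by (auto simp: I_def M_def \<beta>_def g_def d_def relax_feasible_def cone_slack_def add.assoc
        satisfies_cuts_nth less_eq_vec_def matrix_vector_mul_component algebra_simps)
  have box: "node_box v = cbox (node_lo v) (node_up v)"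
    by (auto simp: node_box_def simp flip: interval_cbox)
  have "finite I" "convex (node_box v)" "compact (node_box v)"
    by (simp_all add: I_def box)
  from cone_multipliers_compact[where M = M and \<beta> = \<beta> and g = g and d = d,
      OF this box0 sat0 bound[OF feas] \<open>c' < c\<close>]
  obtain \<theta> l where I: "\<And>i. i \<in> I \<Longrightarrow> norm (\<theta> i) \<le> l i"
    "\<And>x. x \<in> node_box v \<Longrightarrow>
      c' \<le> snd_q P \<omega> \<bullet> x - (\<Sum>i\<in>I. l i * (g i \<bullet> x + d i) - \<theta> i \<bullet> (M i *v x + \<beta> i))"
    by blast
  have l0: "0 \<le> l i" if "i \<in> I" for i
    using I(1)[OF that] norm_ge_zero order_trans by blast
  define \<gamma>1 where "\<gamma>1 = (\<chi> w. l (Inr (Inr w)))"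
  define \<gamma>2 where "\<gamma>2 = (\<lambda>j. l (Inr (Inl j)))"
  \<comment> \<open>The Lagrangian is \<open>q' \<bullet> x + K\<close>: reduced costs, which the
    bounds must pay for, and a constant.\<close>
  define q' where "q' = snd_q P \<omega>
      - (\<Sum>i\<in>{1..snd_m P}. l (Inl i) *\<^sub>R snd_g P \<omega> i - transpose (snd_A P \<omega> i) *v \<theta> (Inl i))
      - transpose (snd_W P \<omega>) *v \<gamma>1 - (\<Sum>j<?n. \<gamma>2 j *\<^sub>R ?\<xi> j)"
  define K where "K = (\<Sum>i\<in>{1..snd_m P}. \<theta> (Inl i) \<bullet> (snd_B P \<omega> i *v y + snd_b P \<omega> i) - l (Inl i) * snd_d P \<omega> i)
      + \<gamma>1 \<bullet> (snd_r P \<omega> - snd_T P \<omega> *v y) + (\<Sum>j<?n. \<gamma>2 j * ?t j)"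
  have lag: "snd_q P \<omega> \<bullet> x - (\<Sum>i\<in>I. l i * (g i \<bullet> x + d i) - \<theta> i \<bullet> (M i *v x + \<beta> i)) = q' \<bullet> x + K" for x
  proof -
    have "(\<Sum>w\<in>UNIV. l (Inr (Inr w)) * (snd_W P \<omega> $ w \<bullet> x + - (snd_r P \<omega> - snd_T P \<omega> *v y) $ w))
        = \<gamma>1 \<bullet> (snd_W P \<omega> *v x - (snd_r P \<omega> - snd_T P \<omega> *v y))"
      by (simp add: inner_vec_def[of "vec_lambda f" for f] \<gamma>1_def matrix_vector_mul_component
          sum.distrib sum_subtractf algebra_simps)
    then have "(\<Sum>i\<in>I. l i * (g i \<bullet> x + d i) - \<theta> i \<bullet> (M i *v x + \<beta> i)) =
        (\<Sum>i\<in>{1..snd_m P}. l (Inl i) * (snd_g P \<omega> i \<bullet> x + snd_d P \<omega> i)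
           - \<theta> (Inl i) \<bullet> (snd_A P \<omega> i *v x + (snd_B P \<omega> i *v y + snd_b P \<omega> i)))
        + (\<Sum>j<?n. \<gamma>2 j * (?\<xi> j \<bullet> x - ?t j))
        + \<gamma>1 \<bullet> (snd_W P \<omega> *v x - (snd_r P \<omega> - snd_T P \<omega> *v y))"
      by (simp add: I_def sum.Plus M_def \<beta>_def g_def d_def \<gamma>2_def)
    then show ?thesis
      by (simp add: q'_def K_def inner_diff_left inner_diff_right inner_add_right inner_sum_left
          dot_lmul_matrix sum.distrib sum_subtractf distrib_left right_diff_distrib)
  qed
  \<comment> \<open>Positive and negative parts of the reduced costs, which restore the dual
    equation. The corner \<open>x\<close> minimises \<open>q'\<close> over the box, and its value is
    exactly the contribution of the bounds to the dual objective.\<close>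
  define \<tau>L :: "real^'l" where "\<tau>L = (\<chi> i. max (q' $ i) 0)"
  define \<tau>U :: "real^'l" where "\<tau>U = (\<chi> i. max (- q' $ i) 0)"
  define x :: "real^'l" where "x = (\<chi> i. if 0 \<le> q' $ i then node_lo v $ i else node_up v $ i)"
  have "node_lo v \<le> node_up v" using box0 by (auto simp: node_box_def)
  then have "x \<in> node_box v"
    by (auto simp: node_box_def x_def less_eq_vec_def)
  moreover have "q' \<bullet> x = node_lo v \<bullet> \<tau>L - node_up v \<bullet> \<tau>U"
    unfolding inner_vec_def sum_subtractf[symmetric]
    by (rule sum.cong) (auto simp: x_def \<tau>L_def \<tau>U_def max_def)
  ultimately have val: "c' \<le> node_lo v \<bullet> \<tau>L - node_up v \<bullet> \<tau>U + K"
    using I(2)[of x] lag[of x] by simp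
  have "q' = \<tau>L - \<tau>U"
    by (auto simp: vec_eq_iff \<tau>L_def \<tau>U_def max_def)
  define \<delta> where "\<delta> = \<lparr>du_theta = \<lambda>i. \<theta> (Inl i), du_lambda = \<lambda>i. l (Inl i), du_gamma1 = \<gamma>1,
    du_gamma2 = \<gamma>2, du_tauL = \<tau>L, du_tauU = \<tau>U\<rparr>"
  have "dual_feasible P \<omega> v \<delta>"
    unfolding dual_feasible_def
  proof (intro conjI ballI allI impI)
    show "norm (du_theta \<delta> i) \<le> du_lambda \<delta> i" "0 \<le> du_lambda \<delta> i" if "i \<in> {1..snd_m P}" for i
      using that I(1)[of "Inl i"] l0[of "Inl i"] by (simp_all add: \<delta>_def I_def InlI)
    show "0 \<le> du_gamma1 \<delta>"
      using l0 by (auto simp: \<delta>_def \<gamma>1_def less_eq_vec_def I_def)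
    show "0 \<le> du_gamma2 \<delta> j" if "j < ?n" for j
      using that l0 by (auto simp: \<delta>_def \<gamma>2_def I_def)
    show "0 \<le> du_tauL \<delta>" "0 \<le> du_tauU \<delta>"
      by (auto simp: \<delta>_def \<tau>L_def \<tau>U_def less_eq_vec_def)
  qed (use \<open>q' = \<tau>L - \<tau>U\<close> in \<open>simp add: \<delta>_def q'_def algebra_simps\<close>)
  moreover have "Rcoef P \<omega> \<delta> \<bullet> y + Scoef P \<omega> v \<delta> = node_lo v \<bullet> \<tau>L - node_up v \<bullet> \<tau>U + K"
    unfolding Rcoef_inner Scoef_def K_def
    by (simp add: \<delta>_def inner_diff_right inner_add_right sum.distrib sum_subtractf
        inner_commute mult.commute)
  ultimately show ?thesis using val by auto
qed

section \<open>Optimality constraints\<close>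

text \<open>\<open>\<sigma>\<close> and \<open>\<gamma>\<close> are multipliers for
  \<open>Fy \<ge> a\<close> and \<open>y \<le> 1\<close>: pairing the vector inequality with
  \<open>y \<ge> 0\<close> turns them into a certificate that the constraint lies below the leaf
  value.\<close>

lemma cut_lp_feasible_le_leaf:
  assumes "cut_lp_feasible P \<omega> V \<delta> lam \<zeta>" and "y \<in> Yset P" and "v \<in> V"
  shows "lam \<bullet> y + \<zeta> \<le> Rcoef P \<omega> (\<delta> v) \<bullet> y + Scoef P \<omega> v (\<delta> v)"
proof -
  obtain \<sigma> \<gamma> where h: "0 \<le> \<sigma> v" "0 \<le> \<gamma> v"
    "lam - Rcoef P \<omega> (\<delta> v) + transpose (fst_F P) *v \<sigma> v - \<gamma> v \<le> 0"
    "\<zeta> - \<sigma> v \<bullet> fst_a P - Scoef P \<omega> v (\<delta> v) + \<gamma> v \<bullet> 1 \<le> 0"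
    using assms unfolding cut_lp_feasible_def by blast
  have y: "fst_a P \<le> fst_F P *v y" "0 \<le> y" "y \<le> 1"
    using assms(2) by (auto simp: Yset_def less_eq_vec_def)
  have "y \<bullet> (lam - Rcoef P \<omega> (\<delta> v) + transpose (fst_F P) *v \<sigma> v - \<gamma> v) \<le> y \<bullet> 0"
    using y h by (intro inner_left_mono_vec)
  then have "lam \<bullet> y - Rcoef P \<omega> (\<delta> v) \<bullet> y + \<sigma> v \<bullet> (fst_F P *v y) - \<gamma> v \<bullet> y \<le> 0"
    by (simp add: inner_commute[of y] inner_diff_left inner_add_left dot_lmul_matrix)
  moreover have "\<sigma> v \<bullet> fst_a P \<le> \<sigma> v \<bullet> (fst_F P *v y)" "\<gamma> v \<bullet> y \<le> \<gamma> v \<bullet> 1"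
    using y h by (auto intro: inner_left_mono_vec)
  ultimately show ?thesis using h(4) by linarith
qed

text \<open>A mixed-integer \<open>x\<close> lies in some leaf and satisfies the cuts there for
  every first-stage \<open>y\<close>, so weak duality at that leaf applies, whichever decision
  produced the tree.\<close>

lemma cut_lp_feasible_valid:
  assumes "cut_lp_feasible P \<omega> V \<delta> lam \<zeta>" and "bc_leaves P \<omega> V"
    and "\<And>v. v \<in> V \<Longrightarrow> dual_feasible P \<omega> v (\<delta> v)"
    and y: "y \<in> first_stage P" and x: "x \<in> sub_feasible P y \<omega>"
  shows "lam \<bullet> y + \<zeta> \<le> snd_q P \<omega> \<bullet> x"
proof -
  have "x \<in> Zbox P \<omega> \<inter> mixed_integer P" using x by (simp add: sub_feasible_def)
  then obtain v where v: "v \<in> V" "x \<in> node_box v"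
    using assms(2) unfolding bc_leaves_def by blast
  have "satisfies_cuts v x"
    using assms(2) v x y unfolding bc_leaves_def by blast
  then have "x \<in> relax_feasible P y \<omega> v"
    using x v by (simp add: relax_feasible_def sub_feasible_def)
  then have "Rcoef P \<omega> (\<delta> v) \<bullet> y + Scoef P \<omega> v (\<delta> v) \<le> snd_q P \<omega> \<bullet> x"
    using assms(3) v(1) by (intro node_weak_duality)
  moreover have "lam \<bullet> y + \<zeta> \<le> Rcoef P \<omega> (\<delta> v) \<bullet> y + Scoef P \<omega> v (\<delta> v)"
    using assms(1) y v(1) by (intro cut_lp_feasible_le_leaf) (auto simp: first_stage_def)
  ultimately show ?thesis by linarith
qed

text \<open>A leaf contains a mixed-integer point \<open>z\<close>, possibly infeasible. Recourse
  keeps its integer coordinates and changes the others, whose bounds at a leaf are the original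
  ones, so the result stays in the leaf.\<close>

lemma leaf_relaxation_nonempty:
  assumes "strict_recourse P" and leaves: "bc_leaves P \<omega> V" and "v \<in> V" and y: "y \<in> first_stage P"
  shows "relax_feasible P y \<omega> v \<noteq> {}"
proof -
  obtain z where z: "z \<in> node_box v" "z \<in> mixed_integer P" "z \<in> Zbox P \<omega>"
    using leaves \<open>v \<in> V\<close> unfolding bc_leaves_def by blast
  then have "\<forall>i\<in>intc P. z $ i \<in> \<int> \<and> snd_zL P \<omega> $ i \<le> z $ i \<and> z $ i \<le> snd_zU P \<omega> $ i"
    by (auto simp: mixed_integer_def Zbox_def less_eq_vec_def)
  then obtain x where x: "x \<in> sub_feasible P y \<omega>" "\<forall>i\<in>intc P. x $ i = z $ i"
    using assms(1) y unfolding strict_recourse_def by blast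
  have cont: "node_lo v $ i = snd_zL P \<omega> $ i \<and> node_up v $ i = snd_zU P \<omega> $ i" if "i \<notin> intc P" for i
    using leaves \<open>v \<in> V\<close> that unfolding bc_leaves_def by blast
  have "node_lo v $ i \<le> x $ i \<and> x $ i \<le> node_up v $ i" for i
    using x z cont[of i]
    by (cases "i \<in> intc P") (auto simp: sub_feasible_def Zbox_def node_box_def less_eq_vec_def)
  then have "x \<in> node_box v" by (simp add: node_box_def less_eq_vec_def)
  moreover have "satisfies_cuts v x"
    using leaves \<open>v \<in> V\<close> x y \<open>x \<in> node_box v\<close> unfolding bc_leaves_def by blast
  ultimately have "x \<in> relax_feasible P y \<omega> v"
    using x by (simp add: relax_feasible_def sub_feasible_def)
  then show ?thesis by blast
qed

(* At a binary y the slope B (2 y - 1) with large B makes every coordinate of lam pull towards y;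
   sigma = 0 suffices. *)
lemma cut_lp_tight_at_binary:
  fixes P :: "('n::finite,'l::finite,'o::finite,'f::finite,'s::finite,'k::finite,'w::finite) problem"
  assumes "finite V" and y: "\<And>j. y $ j \<in> {0, 1}"
    and h: "\<And>v. v \<in> V \<Longrightarrow> h \<le> Rcoef P \<omega> (\<delta> v) \<bullet> y + Scoef P \<omega> v (\<delta> v)"
  shows "\<exists>lam \<zeta>. cut_lp_feasible P \<omega> V \<delta> lam \<zeta> \<and> lam \<bullet> y + \<zeta> = h"
proof -
  \<comment> \<open>Any bound on all coordinates of all \<open>Rcoef\<close> would do; the sum of
    norms is one.\<close>
  define B where "B = (\<Sum>v\<in>V. norm (Rcoef P \<omega> (\<delta> v)))"
  have B: "\<bar>Rcoef P \<omega> (\<delta> v) $ j\<bar> \<le> B" if "v \<in> V" for v j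
  proof -
    have "norm (Rcoef P \<omega> (\<delta> v)) \<le> B"
      unfolding B_def using assms(1) that by (intro member_le_sum) auto
    then show ?thesis using component_le_norm_cart order_trans by blast
  qed
  define lam :: "real^'n" where "lam = (\<chi> j. B * (2 * y $ j - 1))"
  \<comment> \<open>Where \<open>y\<close> is 1 this is exactly the excess of \<open>lam\<close>
    over \<open>Rcoef\<close>; where \<open>y\<close> is 0 there is no excess. So
    \<open>\<gamma> v\<close> is complementary to \<open>1 - y\<close>, and nothing is lost at
    \<open>y\<close>.\<close>
  define \<gamma> :: "'l node \<Rightarrow> real^'n" where "\<gamma> = (\<lambda>v. \<chi> j. y $ j * (B - Rcoef P \<omega> (\<delta> v) $ j))"
  have bin: "y $ j = 0 \<or> y $ j = 1" for j using y[of j] by simp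
  have "cut_lp_feasible P \<omega> V \<delta> lam (h - lam \<bullet> y)"
    unfolding cut_lp_feasible_def
  proof (rule exI[of _ "\<lambda>_. 0"], rule exI[of _ \<gamma>], intro ballI conjI)
    fix v assume v: "v \<in> V"
    show "0 \<le> \<gamma> v"
      unfolding less_eq_vec_def
    proof
      fix j show "0 $ j \<le> \<gamma> v $ j"
        using bin[of j] B[OF v, of j] by (auto simp: \<gamma>_def)
    qed
    show "lam - Rcoef P \<omega> (\<delta> v) + transpose (fst_F P) *v 0 - \<gamma> v \<le> 0"
      unfolding less_eq_vec_def
    proof
      fix j show "(lam - Rcoef P \<omega> (\<delta> v) + transpose (fst_F P) *v 0 - \<gamma> v) $ j \<le> 0 $ j"
        using bin[of j] B[OF v, of j] by (auto simp: \<gamma>_def lam_def)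
    qed
    have "\<gamma> v \<bullet> 1 + Rcoef P \<omega> (\<delta> v) \<bullet> y = lam \<bullet> y"
      unfolding inner_vec_def sum.distrib[symmetric]
    proof (rule sum.cong)
      fix j show "\<gamma> v $ j \<bullet> 1 $ j + Rcoef P \<omega> (\<delta> v) $ j \<bullet> y $ j = lam $ j \<bullet> y $ j"
        using bin[of j] by (auto simp: \<gamma>_def lam_def)
    qed simp
    then show "h - lam \<bullet> y - 0 \<bullet> fst_a P - Scoef P \<omega> v (\<delta> v) + \<gamma> v \<bullet> 1 \<le> 0"
      using h[OF v] by simp
  qed simp
  then show ?thesis by (intro exI[of _ lam] exI[of _ "h - lam \<bullet> y"]) simp
qed

text \<open>Used with \<open>h\<close> the value of the second-stage solution when no leaf is open.
  Each leaf dual value is then at least \<open>h\<close>, and the constraint built at the binary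
  \<open>y\<close> is a competitor of value \<open>h\<close> in the linear program.\<close>

lemma cut_lp_optimal_tight:
  assumes "strict_recourse P" and "y \<in> first_stage P" and "bc_leaves P \<omega> V"
    and dual: "\<And>v. v \<in> V \<Longrightarrow> dual_optimal P y \<omega> v (\<delta> v)"
    and "cut_lp_optimal P y \<omega> V \<delta> lam \<zeta>"
    and h: "\<And>v x. v \<in> V \<Longrightarrow> x \<in> relax_feasible P y \<omega> v \<Longrightarrow> h \<le> snd_q P \<omega> \<bullet> x"
  shows "h \<le> lam \<bullet> y + \<zeta>"
proof -
  have "h \<le> Rcoef P \<omega> (\<delta> v) \<bullet> y + Scoef P \<omega> v (\<delta> v)" if "v \<in> V" for v
  \<comment> \<open>Strong duality yields only values below \<open>h\<close>; the optimal
    \<open>\<delta> v\<close> dominates them all.\<close>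
  proof (rule dense_le)
    fix c assume "c < h"
    from node_strong_duality[OF leaf_relaxation_nonempty[OF assms(1,3) that assms(2)] h[OF that] this]
    obtain \<delta>' where "dual_feasible P \<omega> v \<delta>'" "c \<le> Rcoef P \<omega> \<delta>' \<bullet> y + Scoef P \<omega> v \<delta>'"
      by blast
    then show "c \<le> Rcoef P \<omega> (\<delta> v) \<bullet> y + Scoef P \<omega> v (\<delta> v)"
      using dual[OF that] unfolding dual_optimal_def by force
  qed
  moreover have "finite V" using assms(3) by (simp add: bc_leaves_def)
  moreover have "y $ j \<in> {0, 1}" for j using assms(2) by (auto simp: first_stage_def)
  ultimately obtain lam' \<zeta>' where "cut_lp_feasible P \<omega> V \<delta> lam' \<zeta>'" "lam' \<bullet> y + \<zeta>' = h"
    using cut_lp_tight_at_binary[of V y h P \<omega> \<delta>] by blast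
  then show ?thesis using assms(5) unfolding cut_lp_optimal_def by fastforce
qed

section \<open>Convergence of the algorithm\<close>

text \<open>Recourse enters because a real-valued \<open>INF\<close> over an empty set carries no
  information.\<close>

lemma Q_ge:
  assumes "complete_recourse P" and "y \<in> first_stage P"
    and "\<And>x. x \<in> sub_feasible P y \<omega> \<Longrightarrow> c \<le> snd_q P \<omega> \<bullet> x"
  shows "c \<le> Q P y \<omega>"
  unfolding Q_def using assms by (intro cINF_greatest) (auto simp: complete_recourse_def)

text \<open>A real \<open>SUP\<close> needs a bounded set; expectations under probability vectors
  never exceed the largest value of \<open>f\<close>.\<close>

lemma expectation_le_SUP:
  fixes f :: "'o::finite \<Rightarrow> real"
  assumes "A \<subseteq> distributions" and "p \<in> A"
  shows "(\<Sum>\<omega>\<in>UNIV. p $ \<omega> * f \<omega>) \<le> (SUP p\<in>A. \<Sum>\<omega>\<in>UNIV. p $ \<omega> * f \<omega>)"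
proof (rule cSUP_upper[OF assms(2)], rule bdd_aboveI2)
  fix p assume "p \<in> A"
  then have p: "0 \<le> p $ \<omega>" "(\<Sum>\<omega>\<in>UNIV. p $ \<omega>) = 1" for \<omega>
    using assms(1) by (auto simp: distributions_def)
  have "f \<omega> \<le> Max (range f)" for \<omega> by simp
  then have "(\<Sum>\<omega>\<in>UNIV. p $ \<omega> * f \<omega>) \<le> (\<Sum>\<omega>\<in>UNIV. p $ \<omega> * Max (range f))"
    using p by (intro sum_mono mult_left_mono)
  then show "(\<Sum>\<omega>\<in>UNIV. p $ \<omega> * f \<omega>) \<le> Max (range f)"
    using p(2) by (simp flip: sum_distrib_right)
qed

lemma finite_first_stage: "finite (first_stage P)"
proof (rule finite_subset)
  show "first_stage P \<subseteq> vec_lambda ` (UNIV \<rightarrow>\<^sub>E {0, 1})"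
  proof
    fix y assume "y \<in> first_stage P"
    then have "vec_nth y \<in> UNIV \<rightarrow>\<^sub>E {0, 1}" by (auto simp: first_stage_def)
    then show "y \<in> vec_lambda ` (UNIV \<rightarrow>\<^sub>E {0, 1})"
      by (metis imageI vec_nth_inverse)
  qed
qed (intro finite_imageI finite_PiE; simp)

text \<open>The weights are the worst case only for the iterate at which they were chosen, but as a
  member of the ambiguity set they stay below the supremum at every \<open>y\<close>.\<close>

lemma aggregated_cut_valid:
  assumes "ambiguity P \<subseteq> distributions" and "complete_recourse P"
    and valid: "valid_iteration P \<rho> k" and y: "y \<in> first_stage P"
  shows "fst_c P \<bullet> y + ((\<Sum>\<omega>\<in>UNIV. it_p (\<rho> k) $ \<omega> * (it_lambda (\<rho> k) \<omega> \<bullet> y))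
    + (\<Sum>\<omega>\<in>UNIV. it_p (\<rho> k) $ \<omega> * it_zeta (\<rho> k) \<omega>)) \<le> dr_objective P y"
proof -
  have p: "it_p (\<rho> k) \<in> ambiguity P"
    using valid by (simp add: valid_iteration_def worst_case_distribution_def Let_def)
  have "it_lambda (\<rho> k) \<omega> \<bullet> y + it_zeta (\<rho> k) \<omega> \<le> Q P y \<omega>" for \<omega>
  proof (rule Q_ge[OF assms(2) y])
    fix x assume "x \<in> sub_feasible P y \<omega>"
    then show "it_lambda (\<rho> k) \<omega> \<bullet> y + it_zeta (\<rho> k) \<omega> \<le> snd_q P \<omega> \<bullet> x"
      using valid y
      by (intro cut_lp_feasible_valid[where V = "it_leaves (\<rho> k) \<omega>" and \<delta> = "it_dual (\<rho> k) \<omega>"])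
        (auto simp: valid_iteration_def Let_def cut_lp_optimal_def dual_optimal_def)
  qed
  moreover have "0 \<le> it_p (\<rho> k) $ \<omega>" for \<omega>
    using p assms(1) by (auto simp: distributions_def)
  ultimately have "(\<Sum>\<omega>\<in>UNIV. it_p (\<rho> k) $ \<omega> * (it_lambda (\<rho> k) \<omega> \<bullet> y + it_zeta (\<rho> k) \<omega>))
      \<le> (\<Sum>\<omega>\<in>UNIV. it_p (\<rho> k) $ \<omega> * Q P y \<omega>)"
    by (intro sum_mono mult_left_mono)
  also have "\<dots> \<le> (SUP p\<in>ambiguity P. \<Sum>\<omega>\<in>UNIV. p $ \<omega> * Q P y \<omega>)"
    using assms(1) p by (rule expectation_le_SUP)
  finally show ?thesis
    by (simp add: dr_objective_def distrib_left sum.distrib)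
qed

lemma performs_mono: "performs P \<epsilon> \<rho> k \<Longrightarrow> 1 \<le> j \<Longrightarrow> j \<le> k \<Longrightarrow> performs P \<epsilon> \<rho> j"
  by (simp add: performs_def)

lemma lower_bound_le:
  assumes "ambiguity P \<subseteq> distributions" and "complete_recourse P"
    and "algorithm_run P \<epsilon> \<rho>" and "performs P \<epsilon> \<rho> k" and "y \<in> first_stage P"
  shows "lower_bound P \<rho> k \<le> ereal (dr_objective P y)"
proof -
  \<comment> \<open>Paired with its true worst-case expectation as \<open>\<eta>\<close>, every
    decision satisfies all constraints added so far.\<close>
  have "(y, dr_objective P y - fst_c P \<bullet> y) \<in> master_feasible P \<rho> k"
    unfolding master_feasible_def
  proof (clarsimp simp: assms(5))
    fix j assume "Suc 0 \<le> j" "j < k"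
    then have "valid_iteration P \<rho> j"
      using assms(3,4) performs_mono[of P \<epsilon> \<rho> k j] by (simp add: algorithm_run_def)
    from aggregated_cut_valid[OF assms(1,2) this assms(5)]
    show "(\<Sum>\<omega>\<in>UNIV. it_p (\<rho> j) $ \<omega> * (it_lambda (\<rho> j) \<omega> \<bullet> y))
        + (\<Sum>\<omega>\<in>UNIV. it_p (\<rho> j) $ \<omega> * it_zeta (\<rho> j) \<omega>) \<le> dr_objective P y - fst_c P \<bullet> y"
      by linarith
  qed
  moreover have "k \<noteq> 0" using assms(4) by (auto simp: performs_def)
  ultimately show ?thesis
    unfolding lower_bound_def by (auto intro: INF_lower2)
qed

lemma best_solution_upper_bound:
  assumes "algorithm_run P \<epsilon> \<rho>" and "performs P \<epsilon> \<rho> k"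
  shows "best_solution P \<rho> k \<in> first_stage P
    \<and> ereal (dr_objective P (best_solution P \<rho> k)) \<le> upper_bound P \<rho> k"
  using assms(2)
proof (induction k)
  case 0
  then show ?case by (simp add: performs_def)
next
  case (Suc k)
  have valid: "valid_iteration P \<rho> (Suc k)"
    using assms(1) Suc.prems by (simp add: algorithm_run_def)
  show ?case
  proof (cases "ereal (upper_value P (\<rho> (Suc k))) \<le> upper_bound P \<rho> k")
    case True
    then show ?thesis
      using valid
      by (auto simp: valid_iteration_def Let_def master_optimal_def suitable_accuracy_def min_def)
  next
    case False
    \<comment> \<open>The initial upper bound is infinite, so the first iteration always replaces
      the meaningless initial \<open>best_solution\<close>.\<close>
    then have "k \<noteq> 0" by (intro notI) simp
    then have "performs P \<epsilon> \<rho> k" using Suc.prems performs_mono by fastforce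
    with Suc.IH False show ?thesis by simp
  qed
qed

lemma upper_bound_le: "1 \<le> j \<Longrightarrow> j \<le> k \<Longrightarrow> upper_bound P \<rho> k \<le> ereal (upper_value P (\<rho> j))"
proof (induction k)
  case (Suc k)
  then show ?case
    by (cases "j = Suc k") (auto simp: min.coboundedI1)
qed simp

text \<open>Tightness is applied scenario by scenario; both sides use the weights
  \<open>it_p (\<rho> k)\<close>, so nonnegativity of the weights finishes the argument.\<close>

lemma solved_upper_value_le:
  assumes "ambiguity P \<subseteq> distributions" and "strict_recourse P"
    and valid: "valid_iteration P \<rho> k" and solved: "\<And>\<omega>. solved_to_optimality P (\<rho> k) \<omega>"
  shows "upper_value P (\<rho> k) \<le> fst_c P \<bullet> it_y (\<rho> k)
    + ((\<Sum>\<omega>\<in>UNIV. it_p (\<rho> k) $ \<omega> * (it_lambda (\<rho> k) \<omega> \<bullet> it_y (\<rho> k)))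
    + (\<Sum>\<omega>\<in>UNIV. it_p (\<rho> k) $ \<omega> * it_zeta (\<rho> k) \<omega>))"
proof -
  have "snd_q P \<omega> \<bullet> it_x (\<rho> k) \<omega> \<le> it_lambda (\<rho> k) \<omega> \<bullet> it_y (\<rho> k) + it_zeta (\<rho> k) \<omega>" for \<omega>
    using valid solved[of \<omega>] assms(2)
    by (intro cut_lp_optimal_tight[where V = "it_leaves (\<rho> k) \<omega>" and \<delta> = "it_dual (\<rho> k) \<omega>"])
      (auto simp: valid_iteration_def Let_def master_optimal_def solved_to_optimality_def)
  moreover have "0 \<le> it_p (\<rho> k) $ \<omega>" for \<omega>
    using valid assms(1)
    by (auto simp: valid_iteration_def worst_case_distribution_def Let_def distributions_def)
  ultimately have "(\<Sum>\<omega>\<in>UNIV. it_p (\<rho> k) $ \<omega> * (snd_q P \<omega> \<bullet> it_x (\<rho> k) \<omega>))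
      \<le> (\<Sum>\<omega>\<in>UNIV. it_p (\<rho> k) $ \<omega> * (it_lambda (\<rho> k) \<omega> \<bullet> it_y (\<rho> k) + it_zeta (\<rho> k) \<omega>))"
    by (intro sum_mono mult_left_mono)
  then show ?thesis
    by (simp add: upper_value_def distrib_left sum.distrib)
qed

text \<open>The constraint added at \<open>j\<close> is present in the master problem at
  \<open>k\<close>. At the repeated decision it pushes the master value up to the upper value of
  iteration \<open>j\<close>, which \<open>U\<close> has not exceeded since.\<close>

lemma repeated_decision_closes_gap:
  assumes "ambiguity P \<subseteq> distributions" and "strict_recourse P" and "0 \<le> \<epsilon>"
    and "valid_iteration P \<rho> j" "valid_iteration P \<rho> k"
    and "\<And>\<omega>. solved_to_optimality P (\<rho> j) \<omega>"
    and jk: "1 \<le> j" "j < k" and same: "it_y (\<rho> j) = it_y (\<rho> k)"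
  shows "\<not> continues P \<epsilon> \<rho> k"
proof -
  define u where "u = upper_value P (\<rho> j)"
  \<comment> \<open>From \<open>1 \<le> j < k\<close> follows \<open>1 < k\<close>, so this master
    problem has constraints and a genuine optimum.\<close>
  have k: "(it_y (\<rho> k), it_eta (\<rho> k)) \<in> master_feasible P \<rho> k"
    "\<forall>(y', \<eta>')\<in>master_feasible P \<rho> k. fst_c P \<bullet> it_y (\<rho> k) + it_eta (\<rho> k) \<le> fst_c P \<bullet> y' + \<eta>'"
    using assms(5) jk by (auto simp: valid_iteration_def Let_def master_optimal_def)
  have "(\<Sum>\<omega>\<in>UNIV. it_p (\<rho> j) $ \<omega> * (it_lambda (\<rho> j) \<omega> \<bullet> it_y (\<rho> k)))
      + (\<Sum>\<omega>\<in>UNIV. it_p (\<rho> j) $ \<omega> * it_zeta (\<rho> j) \<omega>) \<le> it_eta (\<rho> k)"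
    using k(1) jk by (auto simp: master_feasible_def)
  then have "u \<le> fst_c P \<bullet> it_y (\<rho> k) + it_eta (\<rho> k)"
    using solved_upper_value_le[OF assms(1,2,4,6)] same by (simp add: u_def)
  then have "ereal u \<le> lower_bound P \<rho> k"
    using k(2) jk unfolding lower_bound_def by (force intro!: INF_greatest)
  moreover have "upper_bound P \<rho> k \<le> ereal u"
    unfolding u_def using jk by (intro upper_bound_le) auto
  ultimately have "upper_bound P \<rho> k - lower_bound P \<rho> k \<le> ereal u - ereal u"
    by (intro ereal_minus_mono)
  also have "\<dots> \<le> ereal \<epsilon>" using assms(3) by simp
  finally show ?thesis by (simp add: continues_def not_less)
qed

text \<open>The loop stops on a gap of at most \<open>\<epsilon>\<close>, hence optimality up to
  \<open>\<epsilon>\<close>, which is exact for tolerance 0. Entries of \<open>\<rho>\<close> that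
  the loop does not reach are arbitrary, so optimality after \<open>N\<close> is demanded only for
  performed iterations.\<close>

theorem theorem2p1:
  fixes P :: "('n::finite,'l::finite,'o::finite,'f::finite,'s::finite,'k::finite,'w::finite) problem"
    and \<rho> :: "('n,'l,'o,'k,'w) run"
    and \<epsilon> :: real and N :: nat
  assumes "convex (ambiguity P)" and "ambiguity P \<subseteq> distributions"
    and "complete_recourse P" and "strict_recourse P"
    and "0 \<le> \<epsilon>"
    and "algorithm_run P \<epsilon> \<rho>"
    and "\<And>k \<omega>. k > N \<Longrightarrow> performs P \<epsilon> \<rho> k \<Longrightarrow> solved_to_optimality P (\<rho> k) \<omega>"
  shows "\<exists>K y. returns_after P \<epsilon> \<rho> K y \<and> dr_optimal_within \<epsilon> P y \<and> (\<epsilon> = 0 \<longrightarrow> dr_optimal P y)"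
proof -
  have "\<exists>k. \<not> continues P \<epsilon> \<rho> k"
  proof (rule ccontr)
    assume "\<not> ?thesis"
    then have perf: "performs P \<epsilon> \<rho> k" if "1 \<le> k" for k
      using that by (simp add: performs_def)
    then have valid: "valid_iteration P \<rho> k" if "1 \<le> k" for k
      using that assms(6) by (simp add: algorithm_run_def)
    then have "(\<lambda>k. it_y (\<rho> k)) ` {N<..} \<subseteq> first_stage P"
      by (fastforce simp: valid_iteration_def Let_def master_optimal_def)
    \<comment> \<open>Pigeonhole over the iterations after \<open>N\<close>, so that the earlier of
      the two visits is already solved to optimality.\<close>
    then have "\<not> inj_on (\<lambda>k. it_y (\<rho> k)) {N<..}"
      using finite_first_stage infinite_Ioi finite_subset finite_imageD by metis
    then obtain j k where jk: "N < j" "j < k" "it_y (\<rho> j) = it_y (\<rho> k)"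
      unfolding inj_on_def by (metis greaterThan_iff linorder_neqE_nat)
    have "\<not> continues P \<epsilon> \<rho> k"
      using jk assms(7)[OF jk(1) perf]
      by (intro repeated_decision_closes_gap[OF assms(2,4,5), of \<rho> j k] valid) auto
    with \<open>\<not> ?thesis\<close> show False by blast
  qed
  \<comment> \<open>The least such index is the one at which the loop really stops: all earlier
    tests succeed, so iteration \<open>K\<close> is performed.\<close>
  then obtain K where K: "\<not> continues P \<epsilon> \<rho> K" "\<And>j. j < K \<Longrightarrow> continues P \<epsilon> \<rho> j"
    using exists_least_iff[of "\<lambda>k. \<not> continues P \<epsilon> \<rho> k"] by blast
  \<comment> \<open>Before the first iteration the gap is
    \<open>\<infinity> - (-\<infinity>) = \<infinity>\<close>.\<close>
  have "continues P \<epsilon> \<rho> 0" by (simp add: continues_def lower_bound_def)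
  then have "1 \<le> K" using K(1) by (cases K) auto
  then have perf: "performs P \<epsilon> \<rho> K" using K(2) by (simp add: performs_def)
  define y where "y = best_solution P \<rho> K"
  have y: "y \<in> first_stage P" "ereal (dr_objective P y) \<le> upper_bound P \<rho> K"
    using best_solution_upper_bound[OF assms(6) perf] by (auto simp: y_def)
  have "dr_objective P y \<le> dr_objective P y' + \<epsilon>" if "y' \<in> first_stage P" for y'
  proof -
    have "ereal (dr_objective P y) - ereal (dr_objective P y') \<le> upper_bound P \<rho> K - lower_bound P \<rho> K"
      using y(2) lower_bound_le[OF assms(2,3,6) perf that] by (rule ereal_minus_mono)
    also have "\<dots> \<le> ereal \<epsilon>" using K(1) by (simp add: continues_def not_less)
    finally show ?thesis by simp
  qed
  then have "dr_optimal_within \<epsilon> P y" "\<epsilon> = 0 \<longrightarrow> dr_optimal P y"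
    using y(1) by (auto simp: dr_optimal_within_def dr_optimal_def)
  moreover have "returns_after P \<epsilon> \<rho> K y"
    using perf K(1) by (simp add: returns_after_def y_def)
  ultimately show ?thesis by blast
qed

end
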